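(* Let $\mathcal{S}_X,\mathcal{S}_Y$ be complete, separable and compact metric spaces, let $\widetilde{c}:\mathcal{S}_X\times\mathcal{S}_Y\to[0,\infty)$ be lower semicontinuous, let $c:\mathcal{S}_X\times\mathcal{S}_X\to[0,\infty)$ be lower semicontinuous with $c(x,x)=0$ for all $x$, let $\mu_0$ and $\nu$ be Borel probability measures on $\mathcal{S}_X$ and $\mathcal{S}_Y$ respectively, and let $\delta\ge0$. Define $h:\mathcal{S}_X\times\mathcal{S}_Y\times\mathbb{R}_+\to\mathbb{R}$ by $$h(w,y,\lambda)=\sup_{x\in\mathcal{S}_X}\{-\widetilde{c}(x,y)-\lambda c(x,w)\}.$$ Then $$G_\delta(\mu_0,\nu)=(-1)\cdot\min_{\lambda\ge0}\Big\{\lambda\delta+\max_{\pi\in\Pi_{W,Y}(\mu_0,\nu)}\mathbb{E}_\pi\big[h(W,Y,\lambda)\big]\Big\}.$$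
   Context: For Borel probability measures $\mu$ on $\mathcal{S}_X$ and $\nu$ on $\mathcal{S}_Y$, $\Pi_{X,Y}(\mu,\nu)$ (written $\Pi_{W,Y}(\mu,\nu)$ when the first coordinate is called $W$) denotes the set of Borel probability measures on $\mathcal{S}_X\times\mathcal{S}_Y$ with first marginal $\mu$ and second marginal $\nu$. The optimal transport cost is $D_{\widetilde{c}}(\mu,\nu)=\min\{\mathbb{E}_\pi\widetilde{c}(X,Y):\pi\in\Pi_{X,Y}(\mu,\nu)\}$. Likewise, for Borel probability measures $\mu_0,\mu$ on $\mathcal{S}_X$, $D_c(\mu_0,\mu)$ is the optimal transport cost between $\mu_0$ and $\mu$ with cost function $c$, i.e. the minimum of $\mathbb{E}_\pi c(U,V)$ over couplings $\pi$ of $U\sim\mu_0$ and $V\sim\mu$. The relaxed optimal transport cost is $$G_\delta(\mu_0,\nu)=\min\{D_{\widetilde{c}}(\mu,\nu):\mu\in\mathcal{D}_\delta(\mu_0)\},\qquad \mathcal{D}_\delta(\mu_0)=\{\mu:\ D_c(\mu_0,\mu)\le\delta\},$$ where $\mu$ ranges over Borel probability measures on $\mathcal{S}_X$.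
   Formalization: The ball D_δ(μ_0) is taken with cost c(V,U), matching c(x,w) in h, since for asymmetric c the identity as written fails; the outer min over λ is an infimum, with attainment claimed only for δ>0, since at δ=0 it can fail to be attained. *)

theory Defs
  imports "HOL-Probability.Probability"
begin

definition lsc :: "('a::topological_space \<Rightarrow> real) \<Rightarrow> bool" where
  "lsc f \<longleftrightarrow> (\<forall>a. open {z. a < f z})"

definition borel_probs :: "'a::topological_space measure set" where
  "borel_probs = {\<mu>. prob_space \<mu> \<and> sets \<mu> = sets borel}"

definition couplings ::
  "'a::topological_space measure \<Rightarrow> 'b::topological_space measure \<Rightarrow> ('a \<times> 'b) measure set" where
  "couplings \<mu> \<nu> = {\<pi> \<in> borel_probs. distr \<pi> borel fst = \<mu> \<and> distr \<pi> borel snd = \<nu>}"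

(* Extended-valued expectation. Lower semicontinuous real costs on a compact space can be unbounded
   above, so a transport cost may be infinite; the Bochner integral would silently give 0 there.
   All integrands used with it have constant sign, so the difference is never "infinity - infinity". *)
definition ext_expectation :: "'a measure \<Rightarrow> ('a \<Rightarrow> real) \<Rightarrow> ereal" where
  "ext_expectation \<pi> f =
     enn2ereal (\<integral>\<^sup>+ z. ennreal (f z) \<partial>\<pi>) - enn2ereal (\<integral>\<^sup>+ z. ennreal (- f z) \<partial>\<pi>)"

definition ot_cost ::
  "('a::topological_space \<Rightarrow> 'b::topological_space \<Rightarrow> real) \<Rightarrow> 'a measure \<Rightarrow> 'b measure \<Rightarrow> ereal" where
  "ot_cost k \<mu> \<nu> = (INF \<pi>\<in>couplings \<mu> \<nu>. ext_expectation \<pi> (\<lambda>(u, v). k u v))"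

definition ot_ball ::
  "('a::topological_space \<Rightarrow> 'a \<Rightarrow> real) \<Rightarrow> real \<Rightarrow> 'a measure \<Rightarrow> 'a measure set" where
  "ot_ball k \<delta> \<mu>\<^sub>0 = {\<mu> \<in> borel_probs. ot_cost k \<mu>\<^sub>0 \<mu> \<le> ereal \<delta>}"

definition relaxed_ot_cost ::
  "('a::topological_space \<Rightarrow> 'b::topological_space \<Rightarrow> real) \<Rightarrow> ('a \<Rightarrow> 'a \<Rightarrow> real) \<Rightarrow> real
    \<Rightarrow> 'a measure \<Rightarrow> 'b measure \<Rightarrow> ereal" where
  "relaxed_ot_cost ct k \<delta> \<mu>\<^sub>0 \<nu> = (INF \<mu>\<in>ot_ball k \<delta> \<mu>\<^sub>0. ot_cost ct \<mu> \<nu>)"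

(* For nonnegative costs and l >= 0 the supremum is over a nonempty set bounded above by 0. *)
definition dual_h ::
  "('a \<Rightarrow> 'b \<Rightarrow> real) \<Rightarrow> ('a \<Rightarrow> 'a \<Rightarrow> real) \<Rightarrow> 'a \<Rightarrow> 'b \<Rightarrow> real \<Rightarrow> real" where
  "dual_h ct c w y l = (SUP x. - ct x y - l * c x w)"

definition dual_objective ::
  "('a::topological_space \<Rightarrow> 'b::topological_space \<Rightarrow> real) \<Rightarrow> ('a \<Rightarrow> 'a \<Rightarrow> real) \<Rightarrow> real
    \<Rightarrow> 'a measure \<Rightarrow> 'b measure \<Rightarrow> real \<Rightarrow> ereal" where
  "dual_objective ct c \<delta> \<mu>\<^sub>0 \<nu> l =
     ereal (l * \<delta>) + (SUP \<pi>\<in>couplings \<mu>\<^sub>0 \<nu>. ext_expectation \<pi> (\<lambda>(w, y). dual_h ct c w y l))"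

end

theory Submission
  imports Defs
begin

text \<open>A compact space has a Borel injection into the real line with uniformly continuous inverse, so
  Helly's selection theorem and Skorohod's representation on the line give weak sequential compactness
  of the probability measures. Both sides of the duality are written in terms of joint laws \<open>\<gamma>\<close>
  of triples \<open>(w, x, y)\<close>, with costs \<open>g \<gamma> = E c(x, w)\<close> and \<open>f \<gamma> = E ct(x, y)\<close>: gluing turns the primal problem
  into minimizing \<open>f\<close> under \<open>g \<le> \<delta>\<close>, and almost minimal choices of \<open>x\<close> turn the inner dual problem into
  minimizing \<open>f + l g\<close>. By compactness the set of pairs \<open>(u, v)\<close> that dominate some \<open>(g \<gamma>, f \<gamma>)\<close>
  is closed and convex, and for \<open>a\<close> below the primal value a line separating \<open>(\<delta>, a)\<close> from it
  yields the multiplier \<open>l\<close>.\<close>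

section \<open>Lower semicontinuous functions\<close>

text \<open>A real lower semicontinuous cost on a compact space can be unbounded above, so every
  value below may be infinite; this dictates the form of the multiplier. A plan of infinite
  deviation gives no point of the convex set that is separated, and is harmless only if its
  Lagrangian is infinite too, which needs \<open>l > 0\<close>. Separating a point strictly below
  the primal value, not the value itself, covers \<open>\<delta> = 0\<close>, where no interior
  (Slater) point exists, and an infinite primal value; the price is an infimum over \<open>l\<close>
  in place of a minimum. Attainment is a separate argument for \<open>\<delta> > 0\<close>, based on
  growth and semicontinuity in \<open>l\<close>. For \<open>\<delta> = 0\<close> the objective is
  minus a nondecreasing function of \<open>l\<close>, and its infimum may be approached only as
  \<open>l\<close> tends to infinity: on [0, 1] with \<open>ct x y = 1 - x\<close>,
  \<open>c x w = (x - w)^2\<close> and \<open>\<mu>\<^sub>0\<close> the unit mass at 0, the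
  objective is 1/(4l) - 1 for l at least 1/2.\<close>

lemma attains_min_sequentially:
  fixes F :: "'a \<Rightarrow> 'b::{complete_linorder, linorder_topology, first_countable_topology}"
  assumes "K \<noteq> {}"
    and sub: "\<And>X. (\<And>n. X n \<in> K) \<Longrightarrow>
      \<exists>r::nat \<Rightarrow> nat. \<exists>l\<in>K. strict_mono r \<and> F l \<le> liminf (\<lambda>n. F (X (r n)))"
  obtains l where "l \<in> K" "\<And>x. x \<in> K \<Longrightarrow> F l \<le> F x"
proof -
  \<comment> \<open>The infimum of the values is a limit of values even when it is infinite.
    Completeness of the order provides this, and lets the lemma serve \<open>ennreal\<close> costs
    and the \<open>ereal\<close> dual objective alike.\<close>
  obtain u where u: "\<And>n. u n \<in> F ` K" "u \<longlonglongrightarrow> Inf (F ` K)"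
    using Inf_as_limit[of "F ` K"] assms(1) by blast
  have "\<exists>x. x \<in> K \<and> u n = F x" for n using u(1)[of n] by auto
  then obtain X where X: "\<And>n. X n \<in> K" "\<And>n. u n = F (X n)" by metis
  have "\<exists>r::nat \<Rightarrow> nat. \<exists>l\<in>K. strict_mono r \<and> F l \<le> liminf (\<lambda>n. F (X (r n)))"
    by (rule sub) (rule X(1))
  then obtain r l where rl: "l \<in> K" "strict_mono (r :: nat \<Rightarrow> nat)" "F l \<le> liminf (\<lambda>n. F (X (r n)))"
    by (elim exE bexE conjE)
  have "(\<lambda>n. F (X (r n))) \<longlonglongrightarrow> Inf (F ` K)"
    using LIMSEQ_subseq_LIMSEQ[OF u(2) rl(2)] by (simp add: o_def X(2))
  then have "liminf (\<lambda>n. F (X (r n))) = Inf (F ` K)"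
    by (intro lim_imp_Liminf) auto
  with rl(3) have "F l \<le> Inf (F ` K)" by simp
  then have "F l \<le> F x" if "x \<in> K" for x
    using INF_lower[OF that, of F] by (rule order_trans)
  with rl(1) that show ?thesis by blast
qed

lemma lsc_borel_measurable:
  "lsc f \<Longrightarrow> f \<in> borel_measurable borel"
  unfolding lsc_def by (auto simp: borel_measurable_iff_greater)

text \<open>\<open>ennreal\<close> cuts negative values off at 0, which preserves lower
  semicontinuity and gives the form that Fatou's lemma consumes.\<close>

lemma lsc_le_liminf:
  assumes "lsc f" "X \<longlonglongrightarrow> x"
  shows "ennreal (f x) \<le> liminf (\<lambda>n. ennreal (f (X n)))"
  unfolding le_Liminf_iff
proof safe
  fix y assume "y < ennreal (f x)"
  then obtain t where t: "0 \<le> t" "y = ennreal t" "t < f x"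
    by (cases y) (auto simp: ennreal_less_iff)
  have "\<forall>\<^sub>F n in sequentially. X n \<in> {z. t < f z}"
    using assms t by (intro topological_tendstoD[OF assms(2)]) (auto simp: lsc_def)
  then show "\<forall>\<^sub>F n in sequentially. y < ennreal (f (X n))"
    by eventually_elim (use t in \<open>auto simp: ennreal_less_iff\<close>)
qed

lemma lsc_attains_min:
  fixes f :: "'a::metric_space \<Rightarrow> real"
  assumes "lsc f" "\<And>x. 0 \<le> f x" "compact K" "K \<noteq> {}"
  obtains l where "l \<in> K" "\<And>x. x \<in> K \<Longrightarrow> f l \<le> f x"
proof (rule attains_min_sequentially[of K "\<lambda>x. ennreal (f x)"])
  fix X :: "nat \<Rightarrow> 'a" assume "\<And>n. X n \<in> K"
  then obtain l r where "l \<in> K" "strict_mono (r::nat\<Rightarrow>nat)" "(X \<circ> r) \<longlonglongrightarrow> l"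
    using seq_compactE[OF assms(3)[unfolded compact_eq_seq_compact_metric]] by metis
  then show "\<exists>r. \<exists>l\<in>K. strict_mono (r::nat\<Rightarrow>nat) \<and> ennreal (f l) \<le> liminf (\<lambda>n. ennreal (f (X (r n))))"
    using lsc_le_liminf[OF assms(1), of "X \<circ> r" l] unfolding o_def by blast
next
  fix l assume "l \<in> K" "\<And>x. x \<in> K \<Longrightarrow> ennreal (f l) \<le> ennreal (f x)"
  then show thesis using assms(2) that by (auto simp: ennreal_le_iff)
qed (use assms in auto)

lemma INF_compact_attained:
  fixes f :: "'a::metric_space \<times> 'b::metric_space \<Rightarrow> real"
  assumes "lsc f" "\<And>z. 0 \<le> f z" "compact K" "K \<noteq> {}"
  obtains x where "x \<in> K" "(INF x\<in>K. f (x, y)) = f (x, y)"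
proof -
  have "lsc (\<lambda>x. f (x, y))"
    using assms(1) unfolding lsc_def
  proof safe
    fix a assume *: "\<forall>a. open {z. a < f z}"
    have "open ((\<lambda>x. (x, y)) -` {z. a < f z})"
      using * by (intro open_vimage spec[OF *] continuous_on_Pair continuous_on_id continuous_on_const)
    then show "open {z. a < f (z, y)}" by (simp add: vimage_def)
  qed
  then obtain x where x: "x \<in> K" "\<And>x'. x' \<in> K \<Longrightarrow> f (x, y) \<le> f (x', y)"
    using lsc_attains_min[of "\<lambda>x. f (x, y)" K, OF _ assms(2-4)] by metis
  then have "(INF x\<in>K. f (x, y)) = f (x, y)"
    by (intro cInf_eq_minimum) auto
  with x(1) that show ?thesis by blast
qed

lemma INF_compact_lower:
  fixes f :: "'a::metric_space \<times> 'b::metric_space \<Rightarrow> real"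
  assumes "\<And>z. 0 \<le> f z" "x \<in> K"
  shows "(INF x\<in>K. f (x, y)) \<le> f (x, y)"
  using assms by (intro cINF_lower bdd_belowI[of _ 0]) auto

lemma INF_compact_nonneg:
  fixes f :: "'a::metric_space \<times> 'b::metric_space \<Rightarrow> real"
  assumes "\<And>z. 0 \<le> f z" "K \<noteq> {}"
  shows "0 \<le> (INF x\<in>K. f (x, y))"
  using assms by (intro cINF_greatest) auto

text \<open>Because the infimum is attained, its sublevel set is the projection of a sublevel set of
  \<open>f\<close> in \<open>K \<times> UNIV\<close>; that set is compact, so its projection is
  closed. The lemma is applied with \<open>K\<close> the whole space, for the envelope, and with
  \<open>K\<close> a small closed ball, for the approximate selection of minimizers.\<close>

lemma lsc_INF_compact:
  fixes f :: "'a::metric_space \<times> 'b::metric_space \<Rightarrow> real"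
  assumes "compact (UNIV :: 'b set)" "lsc f" "\<And>z. 0 \<le> f z" "compact K" "K \<noteq> {}"
  shows "lsc (\<lambda>y. INF x\<in>K. f (x, y))"
  unfolding lsc_def
proof
  fix a
  have eq: "{y. a < (INF x\<in>K. f (x, y))} = - snd ` ((K \<times> UNIV) \<inter> - {z. a < f z})"
  proof (intro set_eqI iffI)
    fix y assume y: "y \<in> {y. a < (INF x\<in>K. f (x, y))}"
    have "a < f (x, y)" if "x \<in> K" for x
      using INF_compact_lower[of f x K y, OF assms(3) that] y by simp
    then show "y \<in> - snd ` ((K \<times> UNIV) \<inter> - {z. a < f z})" by auto
  next
    fix y assume y: "y \<in> - snd ` ((K \<times> UNIV) \<inter> - {z. a < f z})"
    obtain x where x: "x \<in> K" "(INF x\<in>K. f (x, y)) = f (x, y)"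
      using INF_compact_attained[OF assms(2-5), of y] .
    have "(x, y) \<notin> (K \<times> UNIV) \<inter> - {z. a < f z}"
      using y by (metis ComplD image_eqI snd_conv)
    then show "y \<in> {y. a < (INF x\<in>K. f (x, y))}" using x by simp
  qed
  have "closed (- {z. a < f z})" using assms(2) by (auto simp: lsc_def closed_def)
  then have "compact ((K \<times> UNIV) \<inter> - {z. a < f z})"
    using assms(1,4) compact_Times by (intro compact_Int_closed) blast+
  then have "compact (snd ` ((K \<times> UNIV) \<inter> - {z. a < f z}))"
    by (rule compact_continuous_image[rotated]) (rule continuous_on_snd[OF continuous_on_id])
  then show "open {y. a < (INF x\<in>K. f (x, y))}"
    unfolding eq by (intro open_Compl compact_imp_closed)
qed

section \<open>Weak compactness\<close>

instance prod :: (polish_space, polish_space) polish_space ..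

text \<open>Base 3 with digits 0 and 1 leaves a gap: if the first disagreement is at
  \<open>k\<close>, the leading term has size (1/3)^k and the whole tail at most half of that, so
  the sums are at least (1/3)^k / 2 apart. In base 2 the tail could cancel the leading term.\<close>

lemma ternary_digits_agree:
  fixes a b :: "nat \<Rightarrow> real"
  assumes "\<And>n. a n \<in> {0, 1}" "\<And>n. b n \<in> {0, 1}"
    and "\<bar>(\<Sum>n. a n * (1/3)^n) - (\<Sum>n. b n * (1/3)^n)\<bar> < (1/3)^N / 2" "n < N"
  shows "a n = b n"
proof (rule ccontr)
  assume "a n \<noteq> b n"
  define k where "k = (LEAST k. a k \<noteq> b k)"
  have k: "a k \<noteq> b k" "k \<le> n" "\<And>m. m < k \<Longrightarrow> a m = b m"
    subgoal unfolding k_def by (rule LeastI) fact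
    subgoal unfolding k_def by (rule Least_le) fact
    subgoal unfolding k_def by (drule not_less_Least) simp
    done
  define c where "c = (\<lambda>m. (a m - b m) * (1/3)^m)"
  have cb: "\<bar>c m\<bar> \<le> (1/3)^m" for m
    using assms(1)[of m] assms(2)[of m] by (auto simp: c_def)
  have geo: "summable (\<lambda>m. (1/3::real)^m)" by (rule summable_geometric) simp
  have sa: "summable (\<lambda>m. a m * (1/3)^m)" "summable (\<lambda>m. b m * (1/3)^m)"
    by (rule summable_comparison_test'[OF geo, of 0], use assms(1,2) in \<open>auto simp: abs_mult insert_iff\<close>,
      metis abs_0 abs_1 zero_le_one order_refl)+
  have sc: "summable c"
    using summable_diff[OF sa] by (simp add: c_def left_diff_distrib)
  have "(\<Sum>n. a n * (1/3)^n) - (\<Sum>n. b n * (1/3)^n) = suminf c"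
    using suminf_diff[OF sa] by (simp add: c_def left_diff_distrib)
  also have "\<dots> = (\<Sum>m. c (m + Suc k)) + (\<Sum>m<Suc k. c m)"
    by (rule suminf_split_initial_segment[OF sc])
  also have "(\<Sum>m<Suc k. c m) = c k"
    using k(3) by (simp add: c_def)
  finally have eq: "(\<Sum>n. a n * (1/3)^n) - (\<Sum>n. b n * (1/3)^n) = (\<Sum>m. c (m + Suc k)) + c k" .
  have ck: "\<bar>c k\<bar> = (1/3)^k"
    using assms(1)[of k] assms(2)[of k] k(1) by (auto simp: c_def)
  have sg: "(\<lambda>m. (1/3::real)^(m + Suc k)) sums ((1/3)^k / 2)"
    using sums_mult[OF geometric_sums[of "1/3::real"], of "(1/3)^Suc k"] by (simp add: power_add mult_ac)
  have "\<bar>\<Sum>m. c (m + Suc k)\<bar> \<le> (\<Sum>m. (1/3)^(m + Suc k))"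
    using norm_suminf_le[OF _ sums_summable[OF sg], of "\<lambda>m. c (m + Suc k)"] cb
    unfolding real_norm_def by blast
  also have "\<dots> = (1/3)^k / 2" using sg by (simp add: sums_iff)
  finally have "(1/3)^k / 2 \<le> \<bar>(\<Sum>n. a n * (1/3)^n) - (\<Sum>n. b n * (1/3)^n)\<bar>"
    unfolding eq using ck by linarith
  moreover have "(1/3::real)^N \<le> (1/3)^k"
    using k(2) assms(4) by (intro power_decreasing) auto
  ultimately show False using assms(3) by simp
qed

text \<open>\<open>s\<close> writes membership in the sets of a countable basis as ternary digits.
  It is Borel but in general not continuous; only its inverse has to be. By compactness finitely
  many basis sets of small diameter cover the space, so finitely many digits locate a point up to
  \<open>e\<close>.\<close>

lemma compact_real_encoding:
  assumes "compact (UNIV :: 'z::polish_space set)"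
  obtains s :: "'z::polish_space \<Rightarrow> real" where "s \<in> borel_measurable borel" "\<And>z. 0 \<le> s z" "\<And>z. s z < 2"
    "\<And>e. 0 < e \<Longrightarrow> \<exists>d>0. \<forall>z z'. \<bar>s z - s z'\<bar> < d \<longrightarrow> dist z z' < e"
proof -
  obtain B :: "'z set set" where B: "countable B" "topological_basis B"
    using ex_countable_basis by blast
  have "B \<noteq> {}" using topological_basisE[OF B(2) open_UNIV UNIV_I] by blast
  define U where "U = from_nat_into B"
  have rU: "range U = B" unfolding U_def by (rule range_from_nat_into[OF \<open>B \<noteq> {}\<close> B(1)])
  have oU: "open (U n)" for n using topological_basis_open[OF B(2)] rU by blast
  define s where "s z = (\<Sum>n. indicator (U n) z * (1/3::real)^n)" for z
  have ind: "indicator (U n) z \<in> {0, 1 :: real}" for n z by (auto simp: indicator_def)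
  have geo: "(\<lambda>m. (1/3::real)^m) sums (3/2)" using geometric_sums[of "1/3::real"] by simp
  have sm: "summable (\<lambda>n. indicator (U n) z * (1/3::real)^n)" for z
    by (rule summable_comparison_test'[of _ 0, OF sums_summable[OF geo]]) (auto simp: indicator_def)
  show thesis
  proof (rule that[of s])
    show "s \<in> borel_measurable borel"
      unfolding s_def using oU
      by (intro borel_measurable_suminf borel_measurable_times borel_measurable_indicator
          borel_measurable_const) simp
    show "0 \<le> s z" for z unfolding s_def by (intro suminf_nonneg sm) auto
    have "s z \<le> (\<Sum>m. (1/3::real)^m)" for z
      unfolding s_def using geo by (intro suminf_le sm) (auto simp: indicator_def sums_iff)
    then have "s z \<le> 3/2" for z unfolding sums_unique[OF geo, symmetric] .
    then show "s z < 2" for z by (rule order.strict_trans1) simp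
    fix e :: real assume "0 < e"
    define N where "N = {n. \<forall>z\<in>U n. \<forall>z'\<in>U n. dist z z' < e}"
    have "UNIV \<subseteq> (\<Union>n\<in>N. U n)"
    proof
      fix z :: 'z
      obtain V where V: "V \<in> B" "z \<in> V" "V \<subseteq> ball z (e/2)"
        using topological_basisE[OF B(2), of "ball z (e/2)" z] \<open>0 < e\<close> by auto
      obtain n where n: "V = U n" using V(1) rU by auto
      have "dist x y < e" if "x \<in> V" "y \<in> V" for x y
        using that V(3) dist_triangle_half_r[of z x e y] by (auto simp: subset_iff)
      then have "n \<in> N" unfolding N_def n by blast
      with V(2) n show "z \<in> (\<Union>n\<in>N. U n)" by blast
    qed
    then obtain C where C: "C \<subseteq> N" "finite C" "UNIV \<subseteq> (\<Union>n\<in>C. U n)"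
      using compactE_image[OF assms, of N U] oU by metis
    \<comment> \<open>All sets of the finite subcover have index below \<open>k\<close>, so values
      of \<open>s\<close> closer than (1/3)^k / 2 agree on their digits, and a set of the subcover
      that contains \<open>z\<close> also contains \<open>z'\<close>.\<close>
    obtain k where k: "\<And>n. n \<in> C \<Longrightarrow> n < k" using C(2) finite_nat_set_iff_bounded by metis
    show "\<exists>d>0. \<forall>z z'. \<bar>s z - s z'\<bar> < d \<longrightarrow> dist z z' < e"
    proof (intro exI[of _ "(1/3)^k / 2"] conjI allI impI)
      fix z z' assume *: "\<bar>s z - s z'\<bar> < (1/3)^k / 2"
      obtain n where n: "n \<in> C" "z \<in> U n" using C(3) by blast
      have "indicator (U n) z = (indicator (U n) z' :: real)"
        using ternary_digits_agree[of "\<lambda>n. indicator (U n) z" "\<lambda>n. indicator (U n) z'" k n]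
          * k[OF n(1)] ind unfolding s_def by blast
      with n(2) have "z' \<in> U n" by (auto simp: indicator_def split: if_splits)
      then show "dist z z' < e" using n C(1) unfolding N_def by blast
    qed simp
  qed
qed

lemma borel_probsD:
  assumes "M \<in> borel_probs"
  shows "prob_space M" "sets M = sets borel" "space M = UNIV" "measurable M N = measurable borel N"
  using assms sets_eq_imp_space_eq[of M borel] measurable_cong_sets[of M borel N N]
  by (auto simp: borel_probs_def)

lemma distr_borel_probs:
  assumes "M \<in> borel_probs" "f \<in> borel_measurable borel"
  shows "distr M borel f \<in> borel_probs"
  using assms borel_probsD[OF assms(1)]
  by (auto simp: borel_probs_def intro!: prob_space.prob_space_distr)

proposition skorokhod_compact:
  fixes M :: "nat \<Rightarrow> 'z::polish_space measure"
  assumes "compact (UNIV :: 'z set)" "\<And>n. M n \<in> borel_probs"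
  obtains r :: "nat \<Rightarrow> nat" and \<Omega> :: "real measure" and X L where
    "strict_mono r" "prob_space \<Omega>" "\<And>n. X n \<in> borel_measurable \<Omega>"
    "\<And>n. distr \<Omega> borel (X n) = M (r n)" "L \<in> borel_measurable \<Omega>"
    "AE \<omega> in \<Omega>. (\<lambda>n. X n \<omega>) \<longlonglongrightarrow> L \<omega>"
proof -
  note M = borel_probsD[OF assms(2)]
  obtain s :: "'z \<Rightarrow> real" where s[measurable]: "s \<in> borel_measurable borel"
    and bnd: "\<And>z. 0 \<le> s z" "\<And>z. s z < 2"
    and uc: "\<And>e. 0 < e \<Longrightarrow> \<exists>d>0. \<forall>z z'. \<bar>s z - s z'\<bar> < d \<longrightarrow> dist z z' < e"
    using compact_real_encoding[OF assms(1)] by blast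
  have inj: "inj s"
  proof (rule injI, rule ccontr)
    fix x y assume "s x = s y" "x \<noteq> y"
    then show False using uc[of "dist x y"] by (metis abs_zero diff_self less_irrefl zero_less_dist_iff)
  qed
  \<comment> \<open>Limits of encoded points may leave \<open>range s\<close>, so the inverse of
    \<open>s\<close> is extended to the closure, which is moreover a Borel set. The default value of
    \<open>q\<close> off \<open>K\<close> will be met only on a null set.\<close>
  define K where "K = closure (range s)"
  have "uniformly_continuous_on (range s) (inv s)"
    unfolding uniformly_continuous_on_def using uc inj by (fastforce simp: dist_real_def)
  then obtain g where g: "uniformly_continuous_on K g" "\<And>x. x \<in> range s \<Longrightarrow> inv s x = g x"
    unfolding K_def by (rule uniformly_continuous_on_extension_on_closure) blast
  have gs: "g (s z) = z" for z using g(2)[of "s z"] inj by simp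
  have cg: "continuous_on K g" using g(1) by (rule uniformly_continuous_imp_continuous)
  define q where "q t = (if t \<in> K then g t else undefined)" for t
  have q[measurable]: "q \<in> borel_measurable borel"
    unfolding q_def K_def[symmetric]
    by (intro borel_measurable_continuous_on_if cg) (auto simp: K_def)
  have sK: "s z \<in> K" for z unfolding K_def by (rule subsetD[OF closure_subset rangeI])
  have qs: "q (s z) = z" for z using sK gs by (simp add: q_def)
  define m where "m n = distr (M n) borel s" for n
  have m: "real_distribution (m n)" for n
    unfolding m_def by (intro prob_space.real_distribution_distr) (simp_all add: M)
  have "tight m"
    unfolding tight_def
  proof (intro conjI allI impI m)
    fix \<epsilon> :: real assume "0 < \<epsilon>"
    have "measure (m n) {-1<..2} = 1" for n
    proof -
      have "-1 < s z \<and> s z \<le> 2" for z using bnd[of z] by linarith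
      then have "s -` {-1<..2} = UNIV" by auto
      then show ?thesis
        using prob_space.prob_space[OF M(1)] by (simp add: m_def measure_distr M)
    qed
    with \<open>0 < \<epsilon>\<close> show "\<exists>a b. a < b \<and> (\<forall>n. 1 - \<epsilon> < measure (m n) {a<..b})"
      by (intro exI[of _ "-1"] exI[of _ 2]) auto
  qed
  then obtain r L where r: "strict_mono r" and L: "real_distribution L" and wc: "weak_conv_m (m \<circ> r) L"
    using tight_imp_convergent_subsubsequence[of m id] by (auto simp: strict_mono_def simp del: o_apply)
  have "\<exists>(\<Omega> :: real measure) Y Z. prob_space \<Omega> \<and> (\<forall>n. Y n \<in> measurable \<Omega> borel) \<and>
      (\<forall>n. distr \<Omega> borel (Y n) = (m \<circ> r) n) \<and> Z \<in> measurable \<Omega> lborel \<and> distr \<Omega> borel Z = L \<and>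
      (\<forall>x \<in> space \<Omega>. (\<lambda>n. Y n x) \<longlonglongrightarrow> Z x)"
    by (rule Skorohod[OF _ L wc]) (simp add: m)
  then obtain \<Omega> :: "real measure" and Y Z where \<Omega>: "prob_space \<Omega>"
    and Y': "\<forall>n. Y n \<in> borel_measurable \<Omega>" and dY': "\<forall>n. distr \<Omega> borel (Y n) = (m \<circ> r) n"
    and Z: "Z \<in> measurable \<Omega> lborel" and lim': "\<forall>\<omega>\<in>space \<Omega>. (\<lambda>n. Y n \<omega>) \<longlonglongrightarrow> Z \<omega>"
    by (elim exE conjE)
  have Y[measurable]: "Y n \<in> borel_measurable \<Omega>" and dY: "distr \<Omega> borel (Y n) = m (r n)" for n
    using Y' dY' by auto
  have lim: "(\<lambda>n. Y n \<omega>) \<longlonglongrightarrow> Z \<omega>" if "\<omega> \<in> space \<Omega>" for \<omega> using lim' that by blast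
  have [measurable]: "Z \<in> borel_measurable \<Omega>" using Z by simp
  show thesis
  proof (rule that[of r \<Omega> "\<lambda>n \<omega>. q (Y n \<omega>)" "\<lambda>\<omega>. q (Z \<omega>)"])
    fix n
    have "distr \<Omega> borel (\<lambda>\<omega>. q (Y n \<omega>)) = distr (distr (M (r n)) borel s) borel q"
      using dY[of n] by (simp add: distr_distr[symmetric, OF q Y, unfolded o_def] m_def)
    also have "\<dots> = distr (M (r n)) borel (\<lambda>z. z)"
      by (subst distr_distr) (simp_all add: o_def qs M)
    also have "\<dots> = M (r n)" using M(2) by (intro distr_id2) simp
    finally show "distr \<Omega> borel (\<lambda>\<omega>. q (Y n \<omega>)) = M (r n)" .
  next
    have K: "closed K" by (simp add: K_def)
    have "AE \<omega> in \<Omega>. Y n \<omega> \<in> K" for n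
    proof -
      have "AE t in distr (M (r n)) borel s. t \<in> K"
        using K sK by (subst AE_distr_iff) (auto simp: M)
      then have "AE t in distr \<Omega> borel (Y n). t \<in> K" unfolding dY m_def .
      then show ?thesis using K by (subst (asm) AE_distr_iff) auto
    qed
    then have "AE \<omega> in \<Omega>. \<forall>n. Y n \<omega> \<in> K" by (simp add: AE_all_countable)
    with AE_space show "AE \<omega> in \<Omega>. (\<lambda>n. q (Y n \<omega>)) \<longlonglongrightarrow> q (Z \<omega>)"
    proof eventually_elim
      fix \<omega> assume \<omega>: "\<omega> \<in> space \<Omega>" "\<forall>n. Y n \<omega> \<in> K"
      have "Z \<omega> \<in> K" using \<omega> by (intro closed_sequentially[OF K _ lim]) auto
      then have "(\<lambda>n. g (Y n \<omega>)) \<longlonglongrightarrow> g (Z \<omega>)"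
        using continuous_on_tendsto_compose[OF cg lim[OF \<omega>(1)]] \<omega>(2) by auto
      with \<open>Z \<omega> \<in> K\<close> \<omega>(2) show "(\<lambda>n. q (Y n \<omega>)) \<longlonglongrightarrow> q (Z \<omega>)" by (simp add: q_def)
    qed
  qed (use r \<Omega> in simp_all)
qed

lemma nn_integral_lsc_le_liminf:
  assumes "lsc f" "\<And>n. X n \<in> borel_measurable \<Omega>"
    and "AE \<omega> in \<Omega>. (\<lambda>n. X n \<omega>) \<longlonglongrightarrow> L \<omega>"
  shows "(\<integral>\<^sup>+\<omega>. ennreal (f (L \<omega>)) \<partial>\<Omega>) \<le> liminf (\<lambda>n. \<integral>\<^sup>+\<omega>. ennreal (f (X n \<omega>)) \<partial>\<Omega>)"
proof -
  note [measurable] = lsc_borel_measurable[OF assms(1)] assms(2)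
  have "(\<integral>\<^sup>+\<omega>. ennreal (f (L \<omega>)) \<partial>\<Omega>) \<le> (\<integral>\<^sup>+\<omega>. liminf (\<lambda>n. ennreal (f (X n \<omega>))) \<partial>\<Omega>)"
    using assms(3) by (intro nn_integral_mono_AE) (auto elim!: eventually_mono intro: lsc_le_liminf[OF assms(1)])
  also have "\<dots> \<le> liminf (\<lambda>n. \<integral>\<^sup>+\<omega>. ennreal (f (X n \<omega>)) \<partial>\<Omega>)"
    by (intro nn_integral_liminf) simp
  finally show ?thesis .
qed

text \<open>Complements reverse the inequality on closed sets. An open set of a metric space is an
  increasing union of closed sets, so the reversed inequality returns to open sets, which form a
  generating pi-system. This is how marginals of weak limits are identified, where semicontinuity
  supplies one inequality only.\<close>

lemma borel_probs_eqI_open_le: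
  fixes M N :: "'a::metric_space measure"
  assumes M: "M \<in> borel_probs" and N: "N \<in> borel_probs"
    and le: "\<And>U. open U \<Longrightarrow> emeasure M U \<le> emeasure N U"
  shows "M = N"
proof -
  interpret M: prob_space M using borel_probsD[OF M] by simp
  interpret N: prob_space N using borel_probsD[OF N] by simp
  note [simp] = borel_probsD(2,3)[OF M] borel_probsD(2,3)[OF N]
  have cl: "measure N C \<le> measure M C" if "closed C" for C
  proof -
    have "measure M (- C) \<le> measure N (- C)"
      using le[of "- C"] that by (simp add: M.emeasure_eq_measure N.emeasure_eq_measure open_Compl)
    then show ?thesis
      using M.prob_compl[of C] N.prob_compl[of C] that by (simp add: Compl_eq_Diff_UNIV)
  qed
  have op: "emeasure M U = emeasure N U" if "open U" for U
  proof (rule antisym[OF le[OF that]])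
    have "fsigma_in euclidean U"
      using that by (intro open_imp_fsigma_in metrizable_space_euclidean) simp
    then obtain C where C: "\<And>n::nat. closed (C n)" "\<And>n. C n \<subseteq> C (Suc n)" "\<Union> (range C) = U"
      unfolding fsigma_in_ascending by auto
    have inc: "incseq C" using C(2) by (intro incseq_SucI)
    have "(\<lambda>n. emeasure N (C n)) \<longlonglongrightarrow> emeasure N U"
      using Lim_emeasure_incseq[of C N] inc C by (auto intro: borel_closed)
    moreover have "emeasure N (C n) \<le> emeasure M U" for n
    proof -
      have "emeasure N (C n) \<le> emeasure M (C n)"
        using cl[OF C(1)] by (simp add: M.emeasure_eq_measure N.emeasure_eq_measure)
      also have "\<dots> \<le> emeasure M U" using C that by (intro emeasure_mono) auto
      finally show ?thesis .
    qed
    ultimately show "emeasure N U \<le> emeasure M U" by (intro LIMSEQ_le_const2) auto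
  qed
  show ?thesis
  proof (rule measure_eqI_generator_eq[where E="{S. open S}" and \<Omega>=UNIV and A="\<lambda>_. UNIV"])
    show "Int_stable {S :: 'a set. open S}" by (auto simp: Int_stable_def)
  qed (auto simp: op borel_def)
qed

section \<open>Weak limits and compactness of the set of couplings\<close>

lemma couplingsI:
  assumes "\<pi> \<in> borel_probs" "distr \<pi> borel fst = \<mu>" "distr \<pi> borel snd = \<nu>"
  shows "\<pi> \<in> couplings \<mu> \<nu>"
  using assms by (simp add: couplings_def)

lemma couplingsD:
  assumes "\<pi> \<in> couplings \<mu> \<nu>"
  shows "\<pi> \<in> borel_probs" "distr \<pi> borel fst = \<mu>" "distr \<pi> borel snd = \<nu>"
  using assms by (simp_all add: couplings_def)

lemma distr_distr_borel:
  assumes "\<gamma> \<in> borel_probs" "f \<in> borel_measurable borel" "g \<in> borel_measurable borel"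
  shows "distr (distr \<gamma> borel f) borel g = distr \<gamma> borel (\<lambda>x. g (f x))"
  using assms by (subst distr_distr) (simp_all add: borel_probsD o_def)

lemma nn_integral_distr_borel:
  assumes "\<gamma> \<in> borel_probs" "f \<in> borel_measurable borel" "g \<in> borel_measurable borel"
  shows "(\<integral>\<^sup>+x. g x \<partial>distr \<gamma> borel f) = (\<integral>\<^sup>+x. g (f x) \<partial>\<gamma>)"
  using assms by (subst nn_integral_distr) (simp_all add: borel_probsD)

lemma measurable_fst_borel [measurable]:
  "fst \<in> borel_measurable (borel :: ('a::second_countable_topology \<times> 'b::second_countable_topology) measure)"
  by (simp add: borel_prod[symmetric])

lemma measurable_snd_borel [measurable]:
  "snd \<in> borel_measurable (borel :: ('a::second_countable_topology \<times> 'b::second_countable_topology) measure)"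
  by (simp add: borel_prod[symmetric])

text \<open>Weak convergence in the form of the portmanteau theorem that is needed for lower
  semicontinuous costs.\<close>

definition weak_limit :: "(nat \<Rightarrow> 'a::topological_space measure) \<Rightarrow> 'a measure \<Rightarrow> bool" where
  "weak_limit M N \<longleftrightarrow>
     (\<forall>f. lsc f \<longrightarrow> (\<integral>\<^sup>+z. ennreal (f z) \<partial>N) \<le> liminf (\<lambda>n. \<integral>\<^sup>+z. ennreal (f z) \<partial>M n))"

lemma lsc_indicator_open:
  assumes "open U"
  shows "lsc (indicator U :: 'a::topological_space \<Rightarrow> real)"
  unfolding lsc_def
proof
  fix a :: real
  have "{z. a < indicator U z} = (if a < 0 then UNIV else if a < 1 then U else {})"
    by (auto simp: indicator_def)
  then show "open {z. a < indicator U z}" using assms by simp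
qed

text \<open>Preimages of open sets are open, so the weak limit can be tested on their indicators.
  The right-hand side is then constant in \<open>n\<close>, and for probability measures the
  resulting one-sided bound forces equality.\<close>

lemma weak_limit_distr:
  fixes N :: "'z::polish_space measure" and T :: "'z \<Rightarrow> 'a::polish_space"
  assumes "weak_limit M N" "N \<in> borel_probs" "\<And>n. M n \<in> borel_probs" "continuous_on UNIV T"
    and "\<And>n. distr (M n) borel T = \<mu>"
  shows "distr N borel T = \<mu>"
proof (rule borel_probs_eqI_open_le)
  have T[measurable]: "T \<in> borel_measurable borel"
    using assms(4) by (rule borel_measurable_continuous_onI)
  show "distr N borel T \<in> borel_probs" using assms(2) T by (rule distr_borel_probs)
  show "\<mu> \<in> borel_probs" unfolding assms(5)[of 0, symmetric] using assms(3) T by (rule distr_borel_probs)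
  fix U :: "'a set" assume U: "open U"
  have "open (T -` U)" using U assms(4) by (rule open_vimage)
  then have "(\<integral>\<^sup>+z. ennreal (indicator (T -` U) z) \<partial>N)
      \<le> liminf (\<lambda>n. \<integral>\<^sup>+z. ennreal (indicator (T -` U) z) \<partial>M n)"
    using assms(1) lsc_indicator_open unfolding weak_limit_def by blast
  moreover have "(\<integral>\<^sup>+z. ennreal (indicator (T -` U) z) \<partial>P) = emeasure (distr P borel T) U"
    if "P \<in> borel_probs" for P
    using U \<open>open (T -` U)\<close> that
    by (simp add: ennreal_indicator borel_probsD emeasure_distr)
  ultimately show "emeasure (distr N borel T) U \<le> emeasure \<mu> U"
    using assms(2,3) by (simp add: assms(5) Liminf_const)
qed

lemma weak_limit_of_AE_convergent:
  assumes "\<And>n. X n \<in> borel_measurable \<Omega>" "L \<in> borel_measurable \<Omega>"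
    and "AE \<omega> in \<Omega>. (\<lambda>n. X n \<omega>) \<longlonglongrightarrow> L \<omega>"
  shows "weak_limit (\<lambda>n. distr \<Omega> borel (X n)) (distr \<Omega> borel L)"
  unfolding weak_limit_def
proof safe
  fix f :: "'b \<Rightarrow> real" assume f: "lsc f"
  note [measurable] = lsc_borel_measurable[OF f] assms(1,2)
  show "(\<integral>\<^sup>+z. ennreal (f z) \<partial>distr \<Omega> borel L)
      \<le> liminf (\<lambda>n. \<integral>\<^sup>+z. ennreal (f z) \<partial>distr \<Omega> borel (X n))"
    using nn_integral_lsc_le_liminf[OF f assms(1,3)] by (simp add: nn_integral_distr)
qed

proposition weakly_convergent_subsequence:
  fixes M :: "nat \<Rightarrow> 'z::polish_space measure"
  assumes "compact (UNIV :: 'z set)" "\<And>n. M n \<in> borel_probs"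
  obtains r :: "nat \<Rightarrow> nat" and N where
    "strict_mono r" "N \<in> borel_probs" "weak_limit (\<lambda>n. M (r n)) N"
proof (rule skorokhod_compact[OF assms])
  fix r :: "nat \<Rightarrow> nat" and \<Omega> :: "real measure" and X L
  assume *: "strict_mono r" "prob_space \<Omega>" "\<And>n. X n \<in> borel_measurable \<Omega>"
    "\<And>n. distr \<Omega> borel (X n) = M (r n)" "L \<in> borel_measurable \<Omega>"
    "AE \<omega> in \<Omega>. (\<lambda>n. X n \<omega>) \<longlonglongrightarrow> L \<omega>"
  have "distr \<Omega> borel L \<in> borel_probs"
    using *(2,5) by (auto simp: borel_probs_def intro!: prob_space.prob_space_distr)
  with weak_limit_of_AE_convergent[OF *(3,5,6)] *(1,4) that show thesis by simp
qed

lemma couplings_subsequence: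
  fixes \<mu> :: "'a::polish_space measure" and \<nu> :: "'b::polish_space measure"
  assumes "compact (UNIV :: 'a set)" "compact (UNIV :: 'b set)" "\<And>n. \<pi> n \<in> couplings \<mu> \<nu>"
  obtains r :: "nat \<Rightarrow> nat" and N where
    "strict_mono r" "N \<in> couplings \<mu> \<nu>" "weak_limit (\<lambda>n. \<pi> (r n)) N"
proof -
  have "compact (UNIV :: ('a \<times> 'b) set)"
    using compact_Times[OF assms(1,2)] by simp
  then obtain r :: "nat \<Rightarrow> nat" and N where
    N: "strict_mono r" "N \<in> borel_probs" "weak_limit (\<lambda>n. \<pi> (r n)) N"
    by (rule weakly_convergent_subsequence[of \<pi>]) (use couplingsD(1)[OF assms(3)] in auto)
  have "N \<in> couplings \<mu> \<nu>"
    by (intro couplingsI N weak_limit_distr[OF N(3,2)] couplingsD[OF assms(3)] continuous_on_fst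
        continuous_on_snd continuous_on_id)
  with N that show thesis by blast
qed

lemma couplings_nonempty:
  assumes "\<mu> \<in> borel_probs" "\<nu> \<in> borel_probs"
  shows "couplings (\<mu> :: 'a::second_countable_topology measure) (\<nu> :: 'b::second_countable_topology measure) \<noteq> {}"
proof -
  interpret \<mu>: prob_space \<mu> using borel_probsD[OF assms(1)] by simp
  interpret \<nu>: prob_space \<nu> using borel_probsD[OF assms(2)] by simp
  interpret P: pair_prob_space \<mu> \<nu> ..
  have sets: "sets (\<mu> \<Otimes>\<^sub>M \<nu>) = sets borel"
    using sets_pair_measure_cong[OF borel_probsD(2)[OF assms(1)] borel_probsD(2)[OF assms(2)]]
    unfolding borel_prod .
  have "distr (\<mu> \<Otimes>\<^sub>M \<nu>) borel fst = \<mu>"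
  proof (rule measure_eqI)
    fix A assume "A \<in> sets (distr (\<mu> \<Otimes>\<^sub>M \<nu>) borel fst)"
    then have A: "A \<in> sets borel" by simp
    have "emeasure (distr (\<mu> \<Otimes>\<^sub>M \<nu>) borel fst) A = emeasure (\<mu> \<Otimes>\<^sub>M \<nu>) (A \<times> UNIV)"
      using A sets by (subst emeasure_distr)
        (auto simp: sets_eq_imp_space_eq[OF sets] measurable_cong_sets[OF sets refl]
          intro!: arg_cong2[where f=emeasure])
    also have "\<dots> = emeasure \<mu> A"
      using A \<nu>.emeasure_space_1 by (subst \<nu>.emeasure_pair_measure_Times)
        (simp_all add: borel_probsD[OF assms(1)] borel_probsD[OF assms(2)])
    finally show "emeasure (distr (\<mu> \<Otimes>\<^sub>M \<nu>) borel fst) A = emeasure \<mu> A" .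
  qed (simp add: borel_probsD[OF assms(1)])
  moreover have "distr (\<mu> \<Otimes>\<^sub>M \<nu>) borel snd = \<nu>"
  proof (rule measure_eqI)
    fix A assume "A \<in> sets (distr (\<mu> \<Otimes>\<^sub>M \<nu>) borel snd)"
    then have A: "A \<in> sets borel" by simp
    have "emeasure (distr (\<mu> \<Otimes>\<^sub>M \<nu>) borel snd) A = emeasure (\<mu> \<Otimes>\<^sub>M \<nu>) (UNIV \<times> A)"
      using A sets by (subst emeasure_distr)
        (auto simp: sets_eq_imp_space_eq[OF sets] measurable_cong_sets[OF sets refl]
          intro!: arg_cong2[where f=emeasure])
    also have "\<dots> = emeasure \<nu> A"
      using A \<mu>.emeasure_space_1 by (subst \<nu>.emeasure_pair_measure_Times)
        (simp_all add: borel_probsD[OF assms(1)] borel_probsD[OF assms(2)])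
    finally show "emeasure (distr (\<mu> \<Otimes>\<^sub>M \<nu>) borel snd) A = emeasure \<nu> A" .
  qed (simp add: borel_probsD[OF assms(2)])
  ultimately have "\<mu> \<Otimes>\<^sub>M \<nu> \<in> couplings \<mu> \<nu>"
    using sets P.prob_space_axioms by (intro couplingsI) (simp_all add: borel_probs_def)
  then show ?thesis by blast
qed

lemma coupling_minimizer:
  fixes \<mu> :: "'a::polish_space measure" and \<nu> :: "'b::polish_space measure"
  assumes "compact (UNIV :: 'a set)" "compact (UNIV :: 'b set)" "\<mu> \<in> borel_probs" "\<nu> \<in> borel_probs"
    and "lsc f"
  obtains \<pi> where "\<pi> \<in> couplings \<mu> \<nu>"
    "\<And>\<pi>'. \<pi>' \<in> couplings \<mu> \<nu> \<Longrightarrow> (\<integral>\<^sup>+z. ennreal (f z) \<partial>\<pi>) \<le> (\<integral>\<^sup>+z. ennreal (f z) \<partial>\<pi>')"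
proof (rule attains_min_sequentially[OF couplings_nonempty[OF assms(3,4)]])
  fix X :: "nat \<Rightarrow> _" assume "\<And>n. X n \<in> couplings \<mu> \<nu>"
  then obtain r :: "nat \<Rightarrow> nat" and N where
    "strict_mono r" "N \<in> couplings \<mu> \<nu>" "weak_limit (\<lambda>n. X (r n)) N"
    by (rule couplings_subsequence[OF assms(1,2)])
  then show "\<exists>r. \<exists>N\<in>couplings \<mu> \<nu>. strict_mono (r :: nat \<Rightarrow> nat) \<and>
      (\<integral>\<^sup>+z. ennreal (f z) \<partial>N) \<le> liminf (\<lambda>n. \<integral>\<^sup>+z. ennreal (f z) \<partial>X (r n))"
    using assms(5) unfolding weak_limit_def by blast
qed (use that in blast)

section \<open>Gluing\<close>

lemma dense_sequence: "\<exists>p :: nat \<Rightarrow> 'a::polish_space. \<forall>x e. 0 < e \<longrightarrow> (\<exists>k. dist (p k) x < e)"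
proof -
  obtain D :: "'a set" where D: "countable D" "\<And>U. open U \<Longrightarrow> U \<noteq> {} \<Longrightarrow> \<exists>d\<in>D. d \<in> U"
    using countable_dense_exists by metis
  have "D \<noteq> {}" using D(2)[of UNIV] by auto
  show ?thesis
  proof (intro exI[of _ "from_nat_into D"] allI impI)
    fix x :: 'a and e :: real assume "0 < e"
    then obtain d where d: "d \<in> D" "d \<in> ball x e"
      using D(2)[of "ball x e"] by force
    then obtain k where "from_nat_into D k = d"
      using from_nat_into_surj[OF D(1)] by blast
    with d(2) show "\<exists>k. dist (from_nat_into D k) x < e" by (auto simp: dist_commute)
  qed
qed

text \<open>The cells come from the balls of radius \<open>e / 2\<close> around a dense sequence,
  each point going to the first ball that contains it.\<close>

lemma fine_partition:
  assumes "0 < e"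
  obtains i :: "'a::polish_space \<Rightarrow> nat" where
    "i \<in> measurable borel (count_space UNIV)" "\<And>x y. i x = i y \<Longrightarrow> dist x y < e"
proof -
  obtain p :: "nat \<Rightarrow> 'a" where p: "\<forall>x e. 0 < e \<longrightarrow> (\<exists>k. dist (p k) x < e)"
    using dense_sequence by (elim exE)
  define i where "i x = (LEAST k. dist (p k) x < e / 2)" for x
  have i: "dist (p (i x)) x < e / 2" for x
    unfolding i_def by (rule LeastI_ex, rule p[rule_format]) (use assms in simp)
  show thesis
  proof (rule that[of i])
    have "{x. dist (p k) x < e / 2} \<in> sets borel" for k
      using borel_open[OF open_ball, of "p k" "e / 2"] by (simp add: ball_def)
    then show "i \<in> measurable borel (count_space UNIV)"
      unfolding i_def by (intro measurable_Least) (simp add: pred_def)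
    show "dist x y < e" if "i x = i y" for x y
      using i[of x] i[of y] that dist_triangle_half_r[of "p (i x)" x e y] by simp
  qed
qed

text \<open>There are countably many cells, so the null ones together carry no mass. They have to be
  avoided because the gluing density divides by the mass of a cell, and \<open>inverse 0\<close> is
  \<open>top\<close> in \<open>ennreal\<close>.\<close>

lemma AE_cell_mass_nonzero:
  fixes i :: "'a \<Rightarrow> nat"
  assumes "i \<in> measurable M (count_space UNIV)"
  shows "AE x in M. emeasure M (i -` {i x} \<inter> space M) \<noteq> 0"
proof -
  have "AE x in M. emeasure M (i -` {k} \<inter> space M) = 0 \<longrightarrow> i x \<noteq> k" for k
  proof (cases "emeasure M (i -` {k} \<inter> space M) = 0")
    case True
    have "i -` {k} \<inter> space M \<in> sets M" using assms by (rule measurable_sets) simp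
    with True have "i -` {k} \<inter> space M \<in> null_sets M" by auto
    then show ?thesis by (rule AE_I') auto
  qed simp
  then have "AE x in M. \<forall>k. emeasure M (i -` {k} \<inter> space M) = 0 \<longrightarrow> i x \<noteq> k"
    by (simp add: AE_all_countable)
  then show ?thesis by eventually_elim blast
qed

text \<open>The normalization behind both marginals of the gluing: with one pair frozen in cell
  \<open>k\<close>, the density integrates to 1 over the other pair. \<open>T\<close> extracts the
  common coordinate from that other pair.\<close>

lemma nn_integral_cell_density:
  fixes i :: "'a::topological_space \<Rightarrow> nat" and T :: "'b::topological_space \<Rightarrow> 'a"
  assumes \<mu>: "\<mu> \<in> borel_probs" and \<pi>: "\<pi> \<in> borel_probs" "distr \<pi> borel T = \<mu>"
    and T[measurable]: "T \<in> borel_measurable borel" and i[measurable]: "i \<in> measurable borel (count_space UNIV)"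
    and nz: "emeasure \<mu> (i -` {k}) \<noteq> 0"
  shows "(\<integral>\<^sup>+v. (if i (T v) = k then inverse (emeasure \<mu> (i -` {k})) else 0) \<partial>\<pi>) = 1"
proof -
  interpret prob_space \<mu> using borel_probsD[OF \<mu>] by simp
  let ?m = "emeasure \<mu> (i -` {k})"
  have set: "i -` {k} \<in> sets borel" using measurable_sets[OF i, of "{k}"] by simp
  have "(\<integral>\<^sup>+v. (if i (T v) = k then inverse ?m else 0) \<partial>\<pi>)
      = (\<integral>\<^sup>+x. inverse ?m * indicator (i -` {k}) x \<partial>\<mu>)"
    unfolding \<pi>(2)[symmetric]
    by (subst nn_integral_distr_borel[OF \<pi>(1) T])
      (use set in \<open>auto intro!: nn_integral_cong simp: indicator_def\<close>)
  also have "\<dots> = inverse ?m * ?m"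
    using set by (subst nn_integral_cmult_indicator) (simp_all add: borel_probsD[OF \<mu>])
  also have "\<dots> = 1"
    using nz emeasure_finite[of "i -` {k}"]
    unfolding mult.commute[of "inverse _"] divide_ennreal_def[symmetric]
    by (intro ennreal_divide_self) (simp_all add: less_top[symmetric])
  finally show ?thesis .
qed

text \<open>Without disintegration: couple the two plans independently given the cell of a fine
  partition of the common factor, and let the mesh tend to zero.\<close>

lemma approximate_gluing:
  fixes \<pi>\<^sub>1 :: "('w::polish_space \<times> 'x::polish_space) measure" and \<pi>\<^sub>2 :: "('x \<times> 'y::polish_space) measure"
  assumes 1: "\<pi>\<^sub>1 \<in> couplings \<mu>\<^sub>0 \<mu>" and 2: "\<pi>\<^sub>2 \<in> couplings \<mu> \<nu>" and "0 < e"
  obtains G where "G \<in> couplings \<pi>\<^sub>1 \<pi>\<^sub>2" "AE z in G. dist (snd (fst z)) (fst (snd z)) < e"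
proof -
  note P1 = couplingsD[OF 1] and P2 = couplingsD[OF 2]
  have \<mu>: "\<mu> \<in> borel_probs" using distr_borel_probs[OF P2(1) measurable_fst_borel] P2(2) by simp
  interpret p1: prob_space \<pi>\<^sub>1 using borel_probsD[OF P1(1)] by simp
  interpret p2: prob_space \<pi>\<^sub>2 using borel_probsD[OF P2(1)] by simp
  interpret P: pair_prob_space \<pi>\<^sub>1 \<pi>\<^sub>2 ..
  obtain i :: "'x \<Rightarrow> nat" where i[measurable]: "i \<in> measurable borel (count_space UNIV)"
    and fine: "\<And>x y. i x = i y \<Longrightarrow> dist x y < e" using fine_partition[OF \<open>0 < e\<close>] by blast
  define m where "m k = emeasure \<mu> (i -` {k})" for k
  \<comment> \<open>Drawing a cell from \<open>\<mu>\<close> and then both pairs independently, each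
    conditioned on that cell, gives on cell \<open>k\<close> the weight
    \<open>m k * (1 / m k) * (1 / m k) = 1 / m k\<close> relative to the product measure.\<close>
  define \<rho> where "\<rho> z = (if i (snd (fst z)) = i (fst (snd z)) then inverse (m (i (snd (fst z)))) else 0)"
    for z :: "('w \<times> 'x) \<times> ('x \<times> 'y)"
  have sets: "sets (\<pi>\<^sub>1 \<Otimes>\<^sub>M \<pi>\<^sub>2) = sets borel"
    using sets_pair_measure_cong[OF borel_probsD(2)[OF P1(1)] borel_probsD(2)[OF P2(1)]]
    unfolding borel_prod .
  have meas: "measurable (\<pi>\<^sub>1 \<Otimes>\<^sub>M \<pi>\<^sub>2) N = measurable borel N" for N :: "'q measure"
    by (rule measurable_cong_sets[OF sets refl])
  define a where "a z = i (snd (fst z))" for z :: "('w \<times> 'x) \<times> ('x \<times> 'y)"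
  define b where "b z = i (fst (snd z))" for z :: "('w \<times> 'x) \<times> ('x \<times> 'y)"
  have a: "a \<in> measurable borel (count_space UNIV)" unfolding a_def
    by (intro measurable_compose[OF _ i] measurable_compose[OF measurable_fst_borel measurable_snd_borel])
  have b: "b \<in> measurable borel (count_space UNIV)" unfolding b_def
    by (intro measurable_compose[OF _ i] measurable_compose[OF measurable_snd_borel measurable_fst_borel])
  have "{z. a z = b z} = (\<Union>k. a -` {k} \<inter> b -` {k})" by auto
  also have "\<dots> \<in> sets borel"
    using measurable_sets[OF a] measurable_sets[OF b] by (intro sets.countable_UN image_subsetI sets.Int) simp_all
  finally have "(\<lambda>z. if a z = b z then inverse (m (a z)) else 0) \<in> borel_measurable borel"
    by (intro measurable_If borel_measurable_const measurable_compose[OF a]) simp_all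
  then have [measurable]: "\<rho> \<in> borel_measurable borel" unfolding \<rho>_def a_def b_def .
  have [measurable]: "\<rho> \<in> borel_measurable (\<pi>\<^sub>1 \<Otimes>\<^sub>M \<pi>\<^sub>2)" by (simp add: meas)
  define G where "G = density (\<pi>\<^sub>1 \<Otimes>\<^sub>M \<pi>\<^sub>2) \<rho>"
  have sG: "sets G = sets borel" by (simp add: G_def sets)
  have spG: "space G = UNIV" using sets_eq_imp_space_eq[OF sG] by simp
  have nz: "AE x in \<mu>. m (i x) \<noteq> 0"
    using AE_cell_mass_nonzero[of i \<mu>] by (simp add: m_def borel_probsD[OF \<mu>])
  have nz1: "AE u in \<pi>\<^sub>1. m (i (snd u)) \<noteq> 0"
  proof -
    have "AE x in distr \<pi>\<^sub>1 borel snd. m (i x) \<noteq> 0" using nz unfolding P1(3) .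
    then show ?thesis by (subst (asm) AE_distr_iff) (simp_all add: borel_probsD[OF P1(1)])
  qed
  have nz2: "AE u in \<pi>\<^sub>2. m (i (fst u)) \<noteq> 0"
  proof -
    have "AE x in distr \<pi>\<^sub>2 borel fst. m (i x) \<noteq> 0" using nz unfolding P2(2) .
    then show ?thesis by (subst (asm) AE_distr_iff) (simp_all add: borel_probsD[OF P2(1)])
  qed
  have fst: "distr G borel fst = \<pi>\<^sub>1"
  proof (rule measure_eqI)
    fix A assume "A \<in> sets (distr G borel fst)"
    then have [measurable]: "A \<in> sets borel" by simp
    have "emeasure (distr G borel fst) A = emeasure G (fst -` A)"
      by (subst emeasure_distr) (simp_all add: measurable_cong_sets[OF sG refl] spG)
    also have "\<dots> = (\<integral>\<^sup>+z. \<rho> z * indicator (fst -` A) z \<partial>(\<pi>\<^sub>1 \<Otimes>\<^sub>M \<pi>\<^sub>2))"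
      unfolding G_def
      by (subst emeasure_density) (use measurable_sets[OF measurable_fst_borel, of A] in \<open>simp_all add: sets\<close>)
    also have "\<dots> = (\<integral>\<^sup>+z. \<rho> z * indicator A (fst z) \<partial>(\<pi>\<^sub>1 \<Otimes>\<^sub>M \<pi>\<^sub>2))"
      by (intro nn_integral_cong) (simp add: indicator_def)
    also have "\<dots> = (\<integral>\<^sup>+u. \<integral>\<^sup>+v. \<rho> (u, v) * indicator A u \<partial>\<pi>\<^sub>2 \<partial>\<pi>\<^sub>1)"
      by (subst p2.nn_integral_fst[symmetric]) (simp_all add: meas)
    also have "\<dots> = (\<integral>\<^sup>+u. indicator A u \<partial>\<pi>\<^sub>1)"
      using nz1
    proof (intro nn_integral_cong_AE, eventually_elim)
      fix u :: "'w \<times> 'x" assume "m (i (snd u)) \<noteq> 0"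
      moreover have "\<rho> (u, v) = (if i (fst v) = i (snd u) then inverse (m (i (snd u))) else 0)" for v
        by (auto simp: \<rho>_def)
      ultimately have "(\<integral>\<^sup>+v. \<rho> (u, v) \<partial>\<pi>\<^sub>2) = 1"
        using nn_integral_cell_density[OF \<mu> P2(1,2) measurable_fst_borel i, of "i (snd u)"]
        by (simp add: m_def cong: if_cong)
      then show "(\<integral>\<^sup>+v. \<rho> (u, v) * indicator A u \<partial>\<pi>\<^sub>2) = indicator A u"
        by (simp add: indicator_def)
    qed
    also have "\<dots> = emeasure \<pi>\<^sub>1 A" by (subst nn_integral_indicator) (simp_all add: borel_probsD[OF P1(1)])
    finally show "emeasure (distr G borel fst) A = emeasure \<pi>\<^sub>1 A" .
  qed (simp add: borel_probsD[OF P1(1)])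
  have snd: "distr G borel snd = \<pi>\<^sub>2"
  proof (rule measure_eqI)
    fix A assume "A \<in> sets (distr G borel snd)"
    then have [measurable]: "A \<in> sets borel" by simp
    have "emeasure (distr G borel snd) A = emeasure G (snd -` A)"
      by (subst emeasure_distr) (simp_all add: measurable_cong_sets[OF sG refl] spG)
    also have "\<dots> = (\<integral>\<^sup>+z. \<rho> z * indicator (snd -` A) z \<partial>(\<pi>\<^sub>1 \<Otimes>\<^sub>M \<pi>\<^sub>2))"
      unfolding G_def
      by (subst emeasure_density) (use measurable_sets[OF measurable_snd_borel, of A] in \<open>simp_all add: sets\<close>)
    also have "\<dots> = (\<integral>\<^sup>+z. \<rho> z * indicator A (snd z) \<partial>(\<pi>\<^sub>1 \<Otimes>\<^sub>M \<pi>\<^sub>2))"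
      by (intro nn_integral_cong) (simp add: indicator_def)
    also have "\<dots> = (\<integral>\<^sup>+v. \<integral>\<^sup>+u. \<rho> (u, v) * indicator A v \<partial>\<pi>\<^sub>1 \<partial>\<pi>\<^sub>2)"
      by (subst P.nn_integral_snd[symmetric]) (simp_all add: meas case_prod_beta)
    also have "\<dots> = (\<integral>\<^sup>+v. indicator A v \<partial>\<pi>\<^sub>2)"
      using nz2
    proof (intro nn_integral_cong_AE, eventually_elim)
      fix v :: "'x \<times> 'y" assume "m (i (fst v)) \<noteq> 0"
      moreover have "\<rho> (u, v) = (if i (snd u) = i (fst v) then inverse (m (i (fst v))) else 0)" for u
        by (simp add: \<rho>_def)
      ultimately have "(\<integral>\<^sup>+u. \<rho> (u, v) \<partial>\<pi>\<^sub>1) = 1"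
        using nn_integral_cell_density[OF \<mu> P1(1,3) measurable_snd_borel i, of "i (fst v)"]
        by (simp add: m_def cong: if_cong)
      then show "(\<integral>\<^sup>+u. \<rho> (u, v) * indicator A v \<partial>\<pi>\<^sub>1) = indicator A v"
        by (simp add: indicator_def)
    qed
    also have "\<dots> = emeasure \<pi>\<^sub>2 A" by (subst nn_integral_indicator) (simp_all add: borel_probsD[OF P2(1)])
    finally show "emeasure (distr G borel snd) A = emeasure \<pi>\<^sub>2 A" .
  qed (simp add: borel_probsD[OF P2(1)])
  have "emeasure G UNIV = emeasure (distr G borel fst) UNIV"
    by (subst emeasure_distr) (simp_all add: measurable_cong_sets[OF sG refl] spG)
  also have "\<dots> = 1" unfolding fst using p1.emeasure_space_1 by (simp add: borel_probsD[OF P1(1)])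
  finally have "prob_space G" by (intro prob_spaceI) (simp add: spG)
  then have "G \<in> couplings \<pi>\<^sub>1 \<pi>\<^sub>2" using sG fst snd by (intro couplingsI) (simp_all add: borel_probs_def)
  moreover have "AE z in G. dist (snd (fst z)) (fst (snd z)) < e"
    unfolding G_def by (subst AE_density) (auto simp: \<rho>_def intro: fine)
  ultimately show thesis by (rule that)
qed

lemma lsc_continuous: "continuous_on UNIV f \<Longrightarrow> lsc f"
  unfolding lsc_def by (auto intro: open_Collect_less continuous_on_const)

lemma gluing:
  fixes \<pi>\<^sub>1 :: "('w::polish_space \<times> 'x::polish_space) measure" and \<pi>\<^sub>2 :: "('x \<times> 'y::polish_space) measure"
  assumes compact: "compact (UNIV :: 'w set)" "compact (UNIV :: 'x set)" "compact (UNIV :: 'y set)"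
    and 1: "\<pi>\<^sub>1 \<in> couplings \<mu>\<^sub>0 \<mu>" and 2: "\<pi>\<^sub>2 \<in> couplings \<mu> \<nu>"
  obtains \<gamma> :: "('w \<times> 'x \<times> 'y) measure" where "\<gamma> \<in> borel_probs"
    "distr \<gamma> borel (\<lambda>z. (fst z, fst (snd z))) = \<pi>\<^sub>1" "distr \<gamma> borel snd = \<pi>\<^sub>2"
proof -
  have "\<exists>G. G \<in> couplings \<pi>\<^sub>1 \<pi>\<^sub>2 \<and> (AE z in G. dist (snd (fst z)) (fst (snd z)) < 1 / real (Suc n))" for n
    by (rule approximate_gluing[OF 1 2, of "1 / real (Suc n)"]) auto
  then have "\<exists>G. \<forall>n. G n \<in> couplings \<pi>\<^sub>1 \<pi>\<^sub>2 \<and> (AE z in G n. dist (snd (fst z)) (fst (snd z)) < 1 / real (Suc n))"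
    by (intro choice allI)
  then obtain G where G': "\<forall>n. G n \<in> couplings \<pi>\<^sub>1 \<pi>\<^sub>2 \<and> (AE z in G n. dist (snd (fst z)) (fst (snd z)) < 1 / real (Suc n))"
    by (elim exE)
  have G: "G n \<in> couplings \<pi>\<^sub>1 \<pi>\<^sub>2"
    and near: "AE z in G n. dist (snd (fst z)) (fst (snd z)) < 1 / real (Suc n)" for n
    using G' by simp_all
  have "compact (UNIV :: ('w \<times> 'x) set)" "compact (UNIV :: ('x \<times> 'y) set)"
    using compact_Times[OF compact(1,2)] compact_Times[OF compact(2,3)] by simp_all
  then obtain r :: "nat \<Rightarrow> nat" and N where r: "strict_mono r" and N: "N \<in> couplings \<pi>\<^sub>1 \<pi>\<^sub>2"
    and lim: "weak_limit (\<lambda>n. G (r n)) N"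
    by (rule couplings_subsequence[OF _ _ G])
  note NB = couplingsD[OF N]
  \<comment> \<open>\<open>d\<close> is the disagreement between the two copies of the middle
    coordinate. Its integral under \<open>G n\<close> is at most 1 / (n + 1), so lower
    semicontinuity makes it vanish under the weak limit, where the copies agree almost
    surely.\<close>
  define d where "d z = dist (snd (fst z)) (fst (snd z))" for z :: "('w \<times> 'x) \<times> ('x \<times> 'y)"
  have "continuous_on UNIV d" unfolding d_def by (intro continuous_intros)
  then have lsc: "lsc d" by (rule lsc_continuous)
  note [measurable] = lsc_borel_measurable[OF lsc]
  have "(\<integral>\<^sup>+z. ennreal (d z) \<partial>N) \<le> liminf (\<lambda>n. \<integral>\<^sup>+z. ennreal (d z) \<partial>G (r n))"
    using lim lsc unfolding weak_limit_def by blast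
  also have "\<dots> \<le> liminf (\<lambda>n. ennreal (1 / real (Suc (r n))))"
  proof (intro Liminf_mono always_eventually allI)
    fix n
    have "(\<integral>\<^sup>+z. ennreal (d z) \<partial>G (r n)) \<le> (\<integral>\<^sup>+z. ennreal (1 / real (Suc (r n))) \<partial>G (r n))"
      using near[of "r n"] by (intro nn_integral_mono_AE) (auto simp: d_def elim!: eventually_mono intro!: ennreal_leI)
    then show "(\<integral>\<^sup>+z. ennreal (d z) \<partial>G (r n)) \<le> ennreal (1 / real (Suc (r n)))"
      using prob_space.emeasure_space_1[of "G (r n)"] borel_probsD(1)[OF couplingsD(1)[OF G]] by simp
  qed
  also have "\<dots> = 0"
  proof (rule lim_imp_Liminf)
    have "(\<lambda>n. 1 / real (Suc (r n))) \<longlonglongrightarrow> 0"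
      using LIMSEQ_subseq_LIMSEQ[OF LIMSEQ_Suc[OF lim_1_over_n] r] by (simp add: o_def)
    then show "(\<lambda>n. ennreal (1 / real (Suc (r n)))) \<longlonglongrightarrow> 0"
      using tendsto_ennrealI by fastforce
  qed simp
  finally have "AE z in N. d z = 0"
    by (subst (asm) le_zero_eq, subst (asm) nn_integral_0_iff_AE) (simp_all add: borel_probsD[OF NB(1)] d_def)
  then have eq: "AE z in N. (fst (fst z), fst (snd z)) = fst z"
    by eventually_elim (auto simp: d_def prod_eq_iff)
  have T: "(\<lambda>z :: ('w \<times> 'x) \<times> ('x \<times> 'y). (fst (fst z), snd z)) \<in> borel_measurable borel" by measurable
  \<comment> \<open>The first copy of the middle coordinate is dropped. The second pair is kept
    verbatim, while \<open>\<pi>\<^sub>1\<close> is recovered from the almost sure equality of the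
    copies.\<close>
  show thesis
  proof (rule that[of "distr N borel (\<lambda>z. (fst (fst z), snd z))"])
    show "distr N borel (\<lambda>z. (fst (fst z), snd z)) \<in> borel_probs" by (rule distr_borel_probs[OF NB(1) T])
    have "distr N borel (\<lambda>z. (fst (fst z), fst (snd z))) = distr N borel fst"
      by (rule distr_cong_AE) (use eq in \<open>simp_all add: borel_probsD[OF NB(1)]\<close>)
    then show "distr (distr N borel (\<lambda>z. (fst (fst z), snd z))) borel (\<lambda>z. (fst z, fst (snd z))) = \<pi>\<^sub>1"
      using NB(2) by (subst distr_distr_borel[OF NB(1) T]) simp_all
    show "distr (distr N borel (\<lambda>z. (fst (fst z), snd z))) borel snd = \<pi>\<^sub>2"
      using NB(3) by (subst distr_distr_borel[OF NB(1) T]) simp_all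
  qed
qed

section \<open>Plans from pointwise minimization\<close>

text \<open>A point of the dense sequence close to a minimizer has that minimizer in its ball.
  Closeness to the set of minimizers thus becomes an inequality between two Borel functions of
  \<open>z\<close>; the balls are closed so that they are compact and the infimum over them is lower
  semicontinuous in \<open>z\<close>.\<close>

lemma near_minimal_index_ex:
  fixes k :: "'x::polish_space \<times> 'z::metric_space \<Rightarrow> real"
  assumes "compact (UNIV :: 'x set)" "lsc k" "\<And>u. 0 \<le> k u" "0 < e"
    and p: "\<forall>x e. 0 < e \<longrightarrow> (\<exists>j. dist (p j) x < e)"
  shows "\<exists>j. (INF x\<in>cball (p j) e. k (x, z)) \<le> (INF x. k (x, z))"
proof -
  obtain x where x: "(INF x. k (x, z)) = k (x, z)"
    using INF_compact_attained[OF assms(2,3,1), of z] by auto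
  obtain j where "dist (p j) x < e" using p \<open>0 < e\<close> by blast
  then have "x \<in> cball (p j) e" by simp
  then show ?thesis unfolding x using INF_compact_lower[of k x "cball (p j) e" z] assms(3) by blast
qed

text \<open>Replaces measurable selection of a minimizer: points of a dense sequence that lie within
  \<open>1 / (n + 1)\<close> of the set of minimizers are selected measurably, and the resulting plans converge.\<close>

lemma minimizing_plan:
  fixes k :: "'x::polish_space \<times> 'z::polish_space \<Rightarrow> real"
  assumes cx: "compact (UNIV :: 'x set)" and cz: "compact (UNIV :: 'z set)"
    and lsc: "lsc k" and nn: "\<And>u. 0 \<le> k u" and \<pi>: "\<pi> \<in> borel_probs"
  obtains \<gamma> where "\<gamma> \<in> borel_probs" "distr \<gamma> borel snd = \<pi>"
    "(\<integral>\<^sup>+u. ennreal (k u) \<partial>\<gamma>) \<le> (\<integral>\<^sup>+z. ennreal (INF x. k (x, z)) \<partial>\<pi>)"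
proof -
  obtain p :: "nat \<Rightarrow> 'x" where p: "\<forall>x e. 0 < e \<longrightarrow> (\<exists>j. dist (p j) x < e)"
    using dense_sequence by (elim exE)
  define e where "e n = 1 / real (Suc n)" for n
  have e: "0 < e n" for n by (simp add: e_def)
  define \<phi> where "\<phi> z = (INF x. k (x, z))" for z
  define \<psi> where "\<psi> n j z = (INF x\<in>cball (p j) (e n). k (x, z))" for n j z
  have ccb: "compact (cball (p j) (e n))" for n j
    using compact_Int_closed[OF cx closed_cball] by simp
  have ne: "p j \<in> cball (p j) (e n)" for n j using e[of n] by simp
  have \<phi>[measurable]: "\<phi> \<in> borel_measurable borel"
    unfolding \<phi>_def by (intro lsc_borel_measurable lsc_INF_compact cz lsc nn cx) simp
  have \<psi>[measurable]: "\<psi> n j \<in> borel_measurable borel" for n j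
    unfolding \<psi>_def by (intro lsc_borel_measurable lsc_INF_compact cz lsc nn ccb) (use ne in blast)
  define i where "i n z = (LEAST j. \<psi> n j z \<le> \<phi> z)" for n z
  have i: "\<psi> n (i n z) z \<le> \<phi> z" for n z
    unfolding i_def by (rule LeastI_ex)
      (unfold \<psi>_def \<phi>_def, rule near_minimal_index_ex[OF cx lsc nn e p])
  have im: "i n \<in> measurable borel (count_space UNIV)" for n
    unfolding i_def by (intro measurable_Least) (simp add: pred_def)
  define \<sigma> where "\<sigma> n z = p (i n z)" for n z
  have \<sigma>[measurable]: "\<sigma> n \<in> borel_measurable borel" for n
    unfolding \<sigma>_def by (rule measurable_compose[OF im]) simp
  have sel: "\<exists>x'. dist (\<sigma> n z) x' \<le> e n \<and> k (x', z) \<le> \<phi> z" for n z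
  proof -
    obtain x' where x': "x' \<in> cball (p (i n z)) (e n)" "\<psi> n (i n z) z = k (x', z)"
      unfolding \<psi>_def by (rule INF_compact_attained[OF lsc nn ccb]) (use ne in blast)
    then show ?thesis using i[of n z] by (auto simp: \<sigma>_def)
  qed
  define T where "T n z = (\<sigma> n z, z)" for n z
  have T[measurable]: "T n \<in> borel_measurable borel" for n unfolding T_def by measurable
  have G: "distr \<pi> borel (T n) \<in> borel_probs" for n using \<pi> T by (rule distr_borel_probs)
  have "compact (UNIV :: ('x \<times> 'z) set)" using compact_Times[OF cx cz] by simp
  then obtain r :: "nat \<Rightarrow> nat" and \<Omega> :: "real measure" and X L where
    r: "strict_mono r" and \<Omega>: "prob_space \<Omega>" and X[measurable]: "\<And>n. X n \<in> borel_measurable \<Omega>"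
    and dX: "\<And>n. distr \<Omega> borel (X n) = distr \<pi> borel (T (r n))" and L[measurable]: "L \<in> borel_measurable \<Omega>"
    and lim: "AE \<omega> in \<Omega>. (\<lambda>n. X n \<omega>) \<longlonglongrightarrow> L \<omega>"
    by (rule skorokhod_compact[of "\<lambda>n. distr \<pi> borel (T n)", OF _ G]) (rule that; assumption)
  \<comment> \<open>\<open>X n\<close> has the law of the image of \<open>\<pi>\<close> under
    \<open>T (r n)\<close>, so it lies almost surely on the graph of \<open>\<sigma> (r n)\<close>.
    Written as a zero distance, this is a Borel statement that passes through the equality of
    laws.\<close>
  have "AE \<omega> in \<Omega>. dist (fst (X n \<omega>)) (\<sigma> (r n) (snd (X n \<omega>))) = 0" for n
  proof -
    have [measurable]: "(\<lambda>u. dist (fst u) (\<sigma> (r n) (snd u))) \<in> borel_measurable borel"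
      by (intro borel_measurable_dist measurable_fst_borel measurable_compose[OF measurable_snd_borel \<sigma>])
    have "AE u in distr \<pi> borel (T (r n)). dist (fst u) (\<sigma> (r n) (snd u)) = 0"
      by (subst AE_distr_iff) (simp_all add: borel_probsD[OF \<pi>] T_def[symmetric], simp add: T_def)
    then show ?thesis unfolding dX[symmetric] by (subst (asm) AE_distr_iff) simp_all
  qed
  then have "AE \<omega> in \<Omega>. \<forall>n. dist (fst (X n \<omega>)) (\<sigma> (r n) (snd (X n \<omega>))) = 0"
    by (simp only: AE_all_countable) simp
  with lim have "AE \<omega> in \<Omega>. ennreal (k (L \<omega>)) \<le> liminf (\<lambda>n. ennreal (\<phi> (snd (X n \<omega>))))"
  proof eventually_elim
    fix \<omega> assume l: "(\<lambda>n. X n \<omega>) \<longlonglongrightarrow> L \<omega>"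
      and s: "\<forall>n. dist (fst (X n \<omega>)) (\<sigma> (r n) (snd (X n \<omega>))) = 0"
    \<comment> \<open>\<open>k\<close> need not be small at \<open>X n\<close> itself, only at a
      true minimizer nearby, so semicontinuity is applied along these minimizers, which have the
      same limit. They are chosen for each \<open>\<omega>\<close> separately, without
      measurability: along the sequence only \<open>\<phi>\<close> gets integrated.\<close>
    have "\<exists>x'. \<forall>n. dist (\<sigma> (r n) (snd (X n \<omega>))) (x' n) \<le> e (r n)
        \<and> k (x' n, snd (X n \<omega>)) \<le> \<phi> (snd (X n \<omega>))"
      by (intro choice allI sel)
    then obtain x' where x': "\<forall>n. dist (\<sigma> (r n) (snd (X n \<omega>))) (x' n) \<le> e (r n)
        \<and> k (x' n, snd (X n \<omega>)) \<le> \<phi> (snd (X n \<omega>))" by (elim exE)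
    have "(\<lambda>n. e (r n)) \<longlonglongrightarrow> 0"
      unfolding e_def using LIMSEQ_subseq_LIMSEQ[OF LIMSEQ_Suc[OF lim_1_over_n] r] by (simp add: o_def)
    then have "(\<lambda>n. dist (x' n) (fst (X n \<omega>))) \<longlonglongrightarrow> 0"
      by (rule Lim_null_comparison[rotated]) (use x' s in \<open>simp add: dist_commute\<close>)
    moreover have "(\<lambda>n. dist (fst (X n \<omega>)) (fst (L \<omega>))) \<longlonglongrightarrow> 0"
      by (rule tendsto_dist_iff[THEN iffD1]) (rule tendsto_fst[OF l])
    ultimately have null: "(\<lambda>n. dist (x' n) (fst (X n \<omega>)) + dist (fst (X n \<omega>)) (fst (L \<omega>))) \<longlonglongrightarrow> 0"
      by (rule tendsto_add_zero)
    have "norm (dist (x' n) (fst (L \<omega>))) \<le> dist (x' n) (fst (X n \<omega>)) + dist (fst (X n \<omega>)) (fst (L \<omega>))" for n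
      unfolding real_norm_def abs_of_nonneg[OF zero_le_dist] by (rule dist_triangle)
    then have "(\<lambda>n. dist (x' n) (fst (L \<omega>))) \<longlonglongrightarrow> 0"
      by (intro Lim_null_comparison[OF _ null] always_eventually allI)
    then have "x' \<longlonglongrightarrow> fst (L \<omega>)" by (rule tendsto_dist_iff[THEN iffD2])
    then have "(\<lambda>n. (x' n, snd (X n \<omega>))) \<longlonglongrightarrow> (fst (L \<omega>), snd (L \<omega>))"
      by (intro tendsto_Pair tendsto_snd l)
    then have "ennreal (k (L \<omega>)) \<le> liminf (\<lambda>n. ennreal (k (x' n, snd (X n \<omega>))))"
      using lsc_le_liminf[OF lsc] by simp
    also have "\<dots> \<le> liminf (\<lambda>n. ennreal (\<phi> (snd (X n \<omega>))))"
      by (intro Liminf_mono always_eventually allI ennreal_leI) (use x' in blast)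
    finally show "ennreal (k (L \<omega>)) \<le> liminf (\<lambda>n. ennreal (\<phi> (snd (X n \<omega>))))" .
  qed
  then have "(\<integral>\<^sup>+\<omega>. ennreal (k (L \<omega>)) \<partial>\<Omega>) \<le> (\<integral>\<^sup>+\<omega>. liminf (\<lambda>n. ennreal (\<phi> (snd (X n \<omega>)))) \<partial>\<Omega>)"
    by (rule nn_integral_mono_AE)
  also have "\<dots> \<le> liminf (\<lambda>n. \<integral>\<^sup>+\<omega>. ennreal (\<phi> (snd (X n \<omega>))) \<partial>\<Omega>)"
    by (intro nn_integral_liminf measurable_compose[OF X] measurable_compose[OF measurable_snd_borel]
        measurable_compose[OF \<phi> measurable_ennreal])
  \<comment> \<open>The second marginal of \<open>X n\<close> is \<open>\<pi>\<close> for every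
    \<open>n\<close>, so the integrals of the merely semicontinuous \<open>\<phi>\<close> are
    constant in \<open>n\<close>.\<close>
  also have "(\<lambda>n. \<integral>\<^sup>+\<omega>. ennreal (\<phi> (snd (X n \<omega>))) \<partial>\<Omega>) = (\<lambda>n. \<integral>\<^sup>+z. ennreal (\<phi> z) \<partial>\<pi>)"
  proof
    fix n
    have m: "(\<lambda>u::'x \<times> 'z. ennreal (\<phi> (snd u))) \<in> borel_measurable borel"
      by (intro measurable_compose[OF measurable_snd_borel] measurable_compose[OF \<phi> measurable_ennreal])
    have "(\<integral>\<^sup>+\<omega>. ennreal (\<phi> (snd (X n \<omega>))) \<partial>\<Omega>) = (\<integral>\<^sup>+u. ennreal (\<phi> (snd u)) \<partial>distr \<Omega> borel (X n))"
      using m by (subst nn_integral_distr) simp_all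
    also have "\<dots> = (\<integral>\<^sup>+z. ennreal (\<phi> z) \<partial>\<pi>)"
      unfolding dX using m by (subst nn_integral_distr_borel[OF \<pi> T]) (simp_all add: T_def)
    finally show "(\<integral>\<^sup>+\<omega>. ennreal (\<phi> (snd (X n \<omega>))) \<partial>\<Omega>) = (\<integral>\<^sup>+z. ennreal (\<phi> z) \<partial>\<pi>)" .
  qed
  also have "liminf (\<lambda>n. \<integral>\<^sup>+z. ennreal (\<phi> z) \<partial>\<pi>) = (\<integral>\<^sup>+z. ennreal (\<phi> z) \<partial>\<pi>)"
    by (rule Liminf_const) simp
  finally have le: "(\<integral>\<^sup>+\<omega>. ennreal (k (L \<omega>)) \<partial>\<Omega>) \<le> (\<integral>\<^sup>+z. ennreal (\<phi> z) \<partial>\<pi>)" .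
  have LB: "distr \<Omega> borel L \<in> borel_probs"
    using \<Omega> L by (auto simp: borel_probs_def intro!: prob_space.prob_space_distr)
  show thesis
  proof (rule that[OF LB])
    show "distr (distr \<Omega> borel L) borel snd = \<pi>"
    proof (rule weak_limit_distr[OF weak_limit_of_AE_convergent[OF X L lim] LB])
      show "distr \<Omega> borel (X n) \<in> borel_probs" for n unfolding dX by (rule G)
      show "continuous_on UNIV snd" by (intro continuous_on_snd continuous_on_id)
      have "distr \<pi> borel (\<lambda>z. z) = \<pi>" by (rule distr_id2) (simp add: borel_probsD[OF \<pi>])
      then show "distr (distr \<Omega> borel (X n)) borel snd = \<pi>" for n
        unfolding dX by (subst distr_distr_borel[OF \<pi> T]) (simp_all add: T_def)
    qed
    show "(\<integral>\<^sup>+u. ennreal (k u) \<partial>distr \<Omega> borel L) \<le> (\<integral>\<^sup>+z. ennreal (INF x. k (x, z)) \<partial>\<pi>)"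
      using le lsc_borel_measurable[OF lsc] by (subst nn_integral_distr) (simp_all add: \<phi>_def)
  qed
qed

section \<open>Operations on lower semicontinuous costs, and mixtures of measures\<close>

lemma lsc_compose:
  assumes "lsc f" "continuous_on UNIV g"
  shows "lsc (\<lambda>x. f (g x))"
  unfolding lsc_def
proof
  fix a
  have "open (g -` {z. a < f z})" using assms by (intro open_vimage) (auto simp: lsc_def)
  then show "open {z. a < f (g z)}" by (simp add: vimage_def)
qed

lemma lsc_add:
  assumes "lsc f" "lsc g"
  shows "lsc (\<lambda>x. f x + g x)"
  unfolding lsc_def
proof
  fix a
  have "{z. a < f z + g z} = (\<Union>q. {z. q < f z} \<inter> {z. a - q < g z})"
  proof (intro set_eqI iffI)
    fix z assume "z \<in> {z. a < f z + g z}"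
    then obtain q where "a - g z < q" "q < f z" using dense[of "a - g z" "f z"] by auto
    then show "z \<in> (\<Union>q. {z. q < f z} \<inter> {z. a - q < g z})" by (auto intro!: exI[of _ q])
  qed auto
  moreover have "open (\<Union>q. {z. q < f z} \<inter> {z. a - q < g z})"
    using assms by (intro open_UN ballI open_Int) (simp_all add: lsc_def)
  ultimately show "open {z. a < f z + g z}" by simp
qed

lemma lsc_cmult:
  assumes "lsc f" "0 \<le> l"
  shows "lsc (\<lambda>x. l * f x)"
proof (cases "l = 0")
  case False
  with assms(2) have "{z. a < l * f z} = {z. a / l < f z}" for a
    by (auto simp: field_simps)
  then show ?thesis using assms(1) by (simp add: lsc_def)
qed (simp add: lsc_def)

lemma ext_expectation_nonneg:
  assumes "\<And>z. 0 \<le> f z"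
  shows "ext_expectation \<pi> f = enn2ereal (\<integral>\<^sup>+z. ennreal (f z) \<partial>\<pi>)"
  using assms by (simp add: ext_expectation_def ennreal_neg zero_ennreal.rep_eq)

lemma ext_expectation_nonpos:
  assumes "\<And>z. 0 \<le> f z"
  shows "ext_expectation \<pi> (\<lambda>z. - f z) = - enn2ereal (\<integral>\<^sup>+z. ennreal (f z) \<partial>\<pi>)"
  using assms by (simp add: ext_expectation_def ennreal_neg zero_ennreal.rep_eq)

text \<open>A Bernoulli draw decides which of the two laws is sampled. The identity covers all Borel
  integrands at once, as it is applied both to costs and, through indicators, to marginals.\<close>

lemma mixture:
  assumes "\<gamma>\<^sub>1 \<in> borel_probs" "\<gamma>\<^sub>2 \<in> borel_probs" "0 \<le> t" "t \<le> 1"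
  obtains \<gamma> where "\<gamma> \<in> borel_probs"
    "\<forall>f\<in>borel_measurable borel.
      (\<integral>\<^sup>+z. f z \<partial>\<gamma>) = (\<integral>\<^sup>+z. f z \<partial>\<gamma>\<^sub>1) * ennreal t + (\<integral>\<^sup>+z. f z \<partial>\<gamma>\<^sub>2) * ennreal (1 - t)"
proof -
  let ?B = "measure_pmf (bernoulli_pmf t)" and ?N = "\<lambda>b. if b then \<gamma>\<^sub>1 else \<gamma>\<^sub>2"
  have N: "?N \<in> measurable ?B (subprob_algebra borel)"
    using assms by (auto simp: space_subprob_algebra borel_probsD prob_space_imp_subprob_space)
  have int: "(\<integral>\<^sup>+z. f z \<partial>(?B \<bind> ?N)) = (\<integral>\<^sup>+z. f z \<partial>\<gamma>\<^sub>1) * ennreal t + (\<integral>\<^sup>+z. f z \<partial>\<gamma>\<^sub>2) * ennreal (1 - t)"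
    if "f \<in> borel_measurable borel" for f
    using assms(3,4) by (subst nn_integral_bind[OF that N]) simp
  have sets: "sets (?B \<bind> ?N) = sets borel" by (rule sets_bind) (auto simp: assms borel_probsD)
  have "emeasure (?B \<bind> ?N) UNIV = 1"
  proof -
    have "emeasure (?B \<bind> ?N) UNIV = (\<integral>\<^sup>+z. indicator UNIV z \<partial>(?B \<bind> ?N))"
      by (subst nn_integral_indicator) (simp_all add: sets)
    also have "\<dots> = ennreal t + ennreal (1 - t)"
      using prob_space.emeasure_space_1[OF borel_probsD(1)[OF assms(1)]]
        prob_space.emeasure_space_1[OF borel_probsD(1)[OF assms(2)]]
      by (subst int) (simp_all add: borel_probsD[OF assms(1)] borel_probsD[OF assms(2)])
    also have "\<dots> = 1" using assms(3,4) by (simp flip: ennreal_plus)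
    finally show ?thesis .
  qed
  then have "prob_space (?B \<bind> ?N)"
    using sets_eq_imp_space_eq[OF sets] by (intro prob_spaceI) simp
  with sets have "?B \<bind> ?N \<in> borel_probs" unfolding borel_probs_def by blast
  then show thesis by (rule that) (intro ballI int)
qed

lemma mixture_distr:
  assumes "\<gamma>\<^sub>1 \<in> borel_probs" "\<gamma>\<^sub>2 \<in> borel_probs" "\<gamma> \<in> borel_probs" "0 \<le> t" "t \<le> 1"
    and int: "\<forall>f\<in>borel_measurable borel.
      (\<integral>\<^sup>+z. f z \<partial>\<gamma>) = (\<integral>\<^sup>+z. f z \<partial>\<gamma>\<^sub>1) * ennreal t + (\<integral>\<^sup>+z. f z \<partial>\<gamma>\<^sub>2) * ennreal (1 - t)"
    and T[measurable]: "T \<in> borel_measurable borel"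
    and "distr \<gamma>\<^sub>1 borel T = \<mu>" "distr \<gamma>\<^sub>2 borel T = \<mu>"
  shows "distr \<gamma> borel T = \<mu>"
proof (rule measure_eqI)
  show "sets (distr \<gamma> borel T) = sets \<mu>" using assms(8) by auto
  fix A assume "A \<in> sets (distr \<gamma> borel T)"
  then have A[measurable]: "A \<in> sets borel" by simp
  have m: "(\<lambda>z. indicator A (T z) :: ennreal) \<in> borel_measurable borel" by measurable
  have em: "emeasure (distr P borel T) A = (\<integral>\<^sup>+z. indicator A (T z) \<partial>P)" if "P \<in> borel_probs" for P
    using A by (subst nn_integral_distr_borel[OF that T, symmetric]) simp_all
  have "emeasure (distr \<gamma> borel T) A = emeasure \<mu> A * ennreal t + emeasure \<mu> A * ennreal (1 - t)"
    using em[OF assms(1)] em[OF assms(2)] em[OF assms(3)] bspec[OF int m] unfolding assms(8,9) by simp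
  also have "\<dots> = emeasure \<mu> A * ennreal (t + (1 - t))"
    using assms(4,5) by (subst ennreal_plus) (simp_all add: distrib_left)
  finally show "emeasure (distr \<gamma> borel T) A = emeasure \<mu> A" by simp
qed

section \<open>Duality\<close>

text \<open>Upward closedness makes the normal vector of a strictly separating line nonnegative; a small
  perturbation, harmless because \<open>C\<close> lies in the first quadrant, makes it positive.\<close>

lemma separate_upward_closed:
  fixes C :: "(real \<times> real) set"
  assumes "convex C" "closed C" "(\<delta>, a) \<notin> C" "0 \<le> \<delta>"
    and nonneg: "\<And>u v. (u, v) \<in> C \<Longrightarrow> 0 \<le> u \<and> 0 \<le> v"
    and up: "\<And>u v u' v'. (u, v) \<in> C \<Longrightarrow> u \<le> u' \<Longrightarrow> v \<le> v' \<Longrightarrow> (u', v') \<in> C"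
  obtains l where "0 < l" "\<And>u v. (u, v) \<in> C \<Longrightarrow> l * \<delta> + a \<le> v + l * u"
proof -
  have "\<exists>p q b. 0 \<le> p \<and> 0 \<le> q \<and> p * \<delta> + q * a < b \<and> (\<forall>u v. (u, v) \<in> C \<longrightarrow> b < p * u + q * v)"
  proof (cases "C = {}")
    case True
    then show ?thesis by (intro exI[of _ 0] exI[of _ 1]) simp
  next
    case False
    then obtain u v where uv: "(u, v) \<in> C" by auto
    obtain n b where n: "inner n (\<delta>, a) < b" "\<forall>x\<in>C. inner n x > b"
      using separating_hyperplane_closed_point[OF assms(1-3)] by blast
    define p q where "p = fst n" and "q = snd n"
    have n': "n = (p, q)" by (simp add: p_def q_def)
    have lt: "p * \<delta> + q * a < b" using n(1) by (simp add: n')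
    have gt: "b < p * u + q * v" if "(u, v) \<in> C" for u v using n(2) that by (force simp: n')
    have "0 \<le> p"
    proof (rule ccontr)
      assume "\<not> 0 \<le> p"
      \<comment> \<open>Raising the first coordinate by \<open>s\<close> brings the linear form down
        to exactly \<open>b\<close>, against the strict inequality on \<open>C\<close>. The same
        device settles the sign of \<open>q\<close>.\<close>
      define s where "s = (p * u + q * v - b) / (- p)"
      have "0 \<le> s" unfolding s_def using gt[OF uv] \<open>\<not> 0 \<le> p\<close> by (intro divide_nonneg_pos) auto
      then have "b < p * (u + s) + q * v" using up[OF uv] by (intro gt) simp
      moreover have "p * s = - (p * u + q * v - b)" unfolding s_def using \<open>\<not> 0 \<le> p\<close> by (simp add: field_simps)
      ultimately show False by (simp add: distrib_left)
    qed
    moreover have "0 \<le> q"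
    proof (rule ccontr)
      assume "\<not> 0 \<le> q"
      define s where "s = (p * u + q * v - b) / (- q)"
      have "0 \<le> s" unfolding s_def using gt[OF uv] \<open>\<not> 0 \<le> q\<close> by (intro divide_nonneg_pos) auto
      then have "b < p * u + q * (v + s)" using up[OF uv] by (intro gt) simp
      moreover have "q * s = - (p * u + q * v - b)" unfolding s_def using \<open>\<not> 0 \<le> q\<close> by (simp add: field_simps)
      ultimately show False by (simp add: distrib_left)
    qed
    ultimately show ?thesis using lt gt by blast
  qed
  then obtain p q b where pq: "0 \<le> p" "0 \<le> q" "p * \<delta> + q * a < b"
    and gt: "\<And>u v. (u, v) \<in> C \<Longrightarrow> b < p * u + q * v" by blast
  \<comment> \<open>Adding \<open>e\<close> to both coefficients raises the form at
    \<open>(\<delta>, a)\<close> by \<open>e * (\<delta> + a)\<close>, which must not exceed the gap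
    in the numerator. The absolute value allows for negative \<open>a\<close>, and the summand 1
    keeps the denominator positive.\<close>
  define e where "e = (b - (p * \<delta> + q * a)) / (\<delta> + \<bar>a\<bar> + 1)"
  have e: "0 < e" unfolding e_def using pq(3) assms(4) by (intro divide_pos_pos) auto
  have "e * (\<delta> + a) \<le> e * (\<delta> + \<bar>a\<bar> + 1)" using e by (intro mult_left_mono) auto
  also have "\<dots> = b - (p * \<delta> + q * a)" unfolding e_def using assms(4) by simp
  finally have le: "(p + e) * \<delta> + (q + e) * a \<le> b" by (simp add: algebra_simps)
  have qe: "0 < q + e" "0 < p + e" using pq e by auto
  show thesis
  proof (rule that[of "(p + e) / (q + e)"])
    fix u v assume uv: "(u, v) \<in> C"
    have "0 \<le> e * (u + v)" using e nonneg[OF uv] by simp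
    then have "(p + e) * \<delta> + (q + e) * a \<le> (p + e) * u + (q + e) * v"
      using le gt[OF uv] by (simp add: algebra_simps)
    then have "((p + e) * \<delta> + (q + e) * a) / (q + e) \<le> ((p + e) * u + (q + e) * v) / (q + e)"
      using qe by (intro divide_right_mono) auto
    moreover have "((p + e) * \<delta> + (q + e) * a) / (q + e) = (p + e) / (q + e) * \<delta> + a"
      using qe(1) by (subst add_divide_distrib) simp
    moreover have "((p + e) * u + (q + e) * v) / (q + e) = v + (p + e) / (q + e) * u"
      using qe(1) by (subst add_divide_distrib) simp
    ultimately show "(p + e) / (q + e) * \<delta> + a \<le> v + (p + e) / (q + e) * u" by simp
  qed (use qe in simp)
qed

lemma ot_cost_attained:
  fixes k :: "'a::polish_space \<Rightarrow> 'b::polish_space \<Rightarrow> real"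
  assumes "compact (UNIV :: 'a set)" "compact (UNIV :: 'b set)" "\<mu>\<^sub>1 \<in> borel_probs" "\<mu>\<^sub>2 \<in> borel_probs"
    and lsc: "lsc (\<lambda>(u, v). k u v)" and nn: "\<And>u v. 0 \<le> k u v"
  obtains \<pi> where "\<pi> \<in> couplings \<mu>\<^sub>1 \<mu>\<^sub>2" "ot_cost k \<mu>\<^sub>1 \<mu>\<^sub>2 = enn2ereal (\<integral>\<^sup>+u. ennreal (k (fst u) (snd u)) \<partial>\<pi>)"
    "is_arg_min (\<lambda>\<pi>. ext_expectation \<pi> (\<lambda>(u, v). k u v)) (\<lambda>\<pi>. \<pi> \<in> couplings \<mu>\<^sub>1 \<mu>\<^sub>2) \<pi>"
proof (rule coupling_minimizer[OF assms(1-4) lsc])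
  have ee: "ext_expectation \<pi> (\<lambda>(u, v). k u v) = enn2ereal (\<integral>\<^sup>+u. ennreal (k (fst u) (snd u)) \<partial>\<pi>)" for \<pi>
    using nn by (subst ext_expectation_nonneg) (auto simp: case_prod_beta)
  fix \<pi> :: "('a \<times> 'b) measure"
  assume \<pi>: "\<pi> \<in> couplings \<mu>\<^sub>1 \<mu>\<^sub>2"
    "\<And>\<pi>'. \<pi>' \<in> couplings \<mu>\<^sub>1 \<mu>\<^sub>2 \<Longrightarrow> (\<integral>\<^sup>+z. ennreal (case z of (u, v) \<Rightarrow> k u v) \<partial>\<pi>)
      \<le> (\<integral>\<^sup>+z. ennreal (case z of (u, v) \<Rightarrow> k u v) \<partial>\<pi>')"
  then have min: "ext_expectation \<pi> (\<lambda>(u, v). k u v) \<le> ext_expectation \<pi>' (\<lambda>(u, v). k u v)"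
    if "\<pi>' \<in> couplings \<mu>\<^sub>1 \<mu>\<^sub>2" for \<pi>'
    using that unfolding ee by (simp add: case_prod_beta less_eq_ennreal.rep_eq)
  show thesis
  proof (rule that[OF \<pi>(1)])
    show "ot_cost k \<mu>\<^sub>1 \<mu>\<^sub>2 = enn2ereal (\<integral>\<^sup>+u. ennreal (k (fst u) (snd u)) \<partial>\<pi>)"
      unfolding ot_cost_def ee[symmetric] using \<pi>(1) min by (intro antisym INF_lower INF_greatest)
    show "is_arg_min (\<lambda>\<pi>. ext_expectation \<pi> (\<lambda>(u, v). k u v)) (\<lambda>\<pi>. \<pi> \<in> couplings \<mu>\<^sub>1 \<mu>\<^sub>2) \<pi>"
      using \<pi>(1) min by (simp add: is_arg_min_linorder)
  qed
qed

lemma ot_cost_le: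
  fixes k :: "'a::polish_space \<Rightarrow> 'b::polish_space \<Rightarrow> real"
  assumes "\<And>u v. 0 \<le> k u v" "\<pi> \<in> couplings \<mu>\<^sub>1 \<mu>\<^sub>2"
  shows "ot_cost k \<mu>\<^sub>1 \<mu>\<^sub>2 \<le> enn2ereal (\<integral>\<^sup>+u. ennreal (k (fst u) (snd u)) \<partial>\<pi>)"
proof -
  have "ext_expectation \<pi> (\<lambda>(u, v). k u v) = enn2ereal (\<integral>\<^sup>+u. ennreal (k (fst u) (snd u)) \<partial>\<pi>)"
    using assms(1) by (subst ext_expectation_nonneg) (auto simp: case_prod_beta)
  then show ?thesis using assms(2) unfolding ot_cost_def by (metis INF_lower)
qed

section \<open>The primal and the inner dual problem in terms of joint laws\<close>

locale relaxed_transport =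
  fixes ct :: "'x::polish_space \<Rightarrow> 'y::polish_space \<Rightarrow> real" and c :: "'x \<Rightarrow> 'x \<Rightarrow> real"
    and \<mu>\<^sub>0 :: "'x measure" and \<nu> :: "'y measure"
  assumes compact_x: "compact (UNIV :: 'x set)" and compact_y: "compact (UNIV :: 'y set)"
    and ct_nonneg: "\<And>x y. 0 \<le> ct x y" and ct_lsc: "lsc (\<lambda>(x, y). ct x y)"
    and c_nonneg: "\<And>x w. 0 \<le> c x w" and c_lsc: "lsc (\<lambda>(x, w). c x w)" and c_refl: "\<And>x. c x x = 0"
    and \<mu>\<^sub>0: "\<mu>\<^sub>0 \<in> borel_probs" and \<nu>: "\<nu> \<in> borel_probs"
begin

text \<open>Joint laws of triples \<open>(w, x, y)\<close>: \<open>w\<close> is moved to \<open>x\<close>, which is then transported to \<open>y\<close>.\<close>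

definition plans :: "('x \<times> 'x \<times> 'y) measure set" where
  "plans = {\<gamma> \<in> borel_probs. distr \<gamma> borel fst = \<mu>\<^sub>0 \<and> distr \<gamma> borel (\<lambda>z. snd (snd z)) = \<nu>}"

definition transport :: "('x \<times> 'x \<times> 'y) measure \<Rightarrow> ennreal" where
  "transport \<gamma> = (\<integral>\<^sup>+z. ennreal (ct (fst (snd z)) (snd (snd z))) \<partial>\<gamma>)"

definition deviation :: "('x \<times> 'x \<times> 'y) measure \<Rightarrow> ennreal" where
  "deviation \<gamma> = (\<integral>\<^sup>+z. ennreal (c (fst (snd z)) (fst z)) \<partial>\<gamma>)"

text \<open>This is minus \<open>dual_h\<close>: with this sign the integrand is nonnegative, its
  integral lives in \<open>ennreal\<close>, and the inner maximum of the dual problem becomes a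
  minimum.\<close>

definition envelope :: "real \<Rightarrow> 'x \<times> 'y \<Rightarrow> real" where
  "envelope l u = (INF x. ct x (snd u) + l * c x (fst u))"

lemma plansD:
  assumes "\<gamma> \<in> plans"
  shows "\<gamma> \<in> borel_probs" "distr \<gamma> borel fst = \<mu>\<^sub>0" "distr \<gamma> borel (\<lambda>z. snd (snd z)) = \<nu>"
  using assms by (simp_all add: plans_def)

lemma ct_compose_lsc:
  assumes "continuous_on UNIV f" "continuous_on UNIV g"
  shows "lsc (\<lambda>z. ct (f z) (g z))"
  using lsc_compose[OF ct_lsc continuous_on_Pair[OF assms]] by simp

lemma c_compose_lsc:
  assumes "continuous_on UNIV f" "continuous_on UNIV g"
  shows "lsc (\<lambda>z. c (f z) (g z))"
  using lsc_compose[OF c_lsc continuous_on_Pair[OF assms]] by simp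

lemma transport_cost_lsc: "lsc (\<lambda>z :: 'x \<times> 'x \<times> 'y. ct (fst (snd z)) (snd (snd z)))"
  by (intro ct_compose_lsc continuous_on_fst continuous_on_snd continuous_on_id)

lemma deviation_cost_lsc: "lsc (\<lambda>z :: 'x \<times> 'x \<times> 'y. c (fst (snd z)) (fst z))"
  by (intro c_compose_lsc continuous_on_fst continuous_on_snd continuous_on_id)

lemma kernel_lsc:
  "0 \<le> l \<Longrightarrow> lsc (\<lambda>q :: 'x \<times> 'x \<times> 'y. ct (fst q) (snd (snd q)) + l * c (fst q) (fst (snd q)))"
  by (intro lsc_add lsc_cmult ct_compose_lsc c_compose_lsc continuous_on_fst continuous_on_snd continuous_on_id)

lemma kernel_nonneg: "0 \<le> l \<Longrightarrow> 0 \<le> ct x y + l * c x w"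
  using ct_nonneg[of x y] c_nonneg[of x w] by simp

lemma compact_xy: "compact (UNIV :: ('x \<times> 'y) set)"
  using compact_Times[OF compact_x compact_y] by simp

lemma compact_xxy: "compact (UNIV :: ('x \<times> 'x \<times> 'y) set)"
  using compact_Times[OF compact_x compact_xy] by simp

lemma envelope_lsc: "0 \<le> l \<Longrightarrow> lsc (envelope l)"
  using lsc_INF_compact[OF compact_xy kernel_lsc kernel_nonneg compact_x] unfolding envelope_def by simp

lemma envelope_attained:
  assumes "0 \<le> l"
  obtains x where "envelope l u = ct x (snd u) + l * c x (fst u)"
  using INF_compact_attained[OF kernel_lsc[OF assms] kernel_nonneg[OF assms] compact_x, of u]
  unfolding envelope_def by auto

lemma envelope_le: "0 \<le> l \<Longrightarrow> envelope l u \<le> ct x (snd u) + l * c x (fst u)"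
  using INF_compact_lower[of "\<lambda>q. ct (fst q) (snd (snd q)) + l * c (fst q) (fst (snd q))" x UNIV u,
      OF kernel_nonneg]
  unfolding envelope_def by simp

lemma envelope_nonneg: "0 \<le> l \<Longrightarrow> 0 \<le> envelope l u"
  using INF_compact_nonneg[of "\<lambda>q. ct (fst q) (snd (snd q)) + l * c (fst q) (fst (snd q))" UNIV u,
      OF kernel_nonneg]
  unfolding envelope_def by simp

lemma dual_h_eq: "dual_h ct c w y l = - envelope l (w, y)"
proof -
  have "uminus ` range (\<lambda>x. ct x y + l * c x w) = range (\<lambda>x. - ct x y - l * c x w)"
    by (auto simp: image_image)
  then show ?thesis by (simp add: dual_h_def envelope_def Inf_real_def)
qed

lemma lagrangian_eq:
  assumes "\<gamma> \<in> borel_probs" "0 \<le> l"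
  shows "transport \<gamma> + ennreal l * deviation \<gamma>
    = (\<integral>\<^sup>+z. ennreal (ct (fst (snd z)) (snd (snd z)) + l * c (fst (snd z)) (fst z)) \<partial>\<gamma>)"
proof -
  have m: "(\<lambda>z. ennreal (ct (fst (snd z)) (snd (snd z)))) \<in> borel_measurable \<gamma>"
    "(\<lambda>z. ennreal (c (fst (snd z)) (fst z))) \<in> borel_measurable \<gamma>"
    using lsc_borel_measurable[OF transport_cost_lsc] lsc_borel_measurable[OF deviation_cost_lsc]
    by (simp_all add: borel_probsD(4)[OF assms(1)])
  have "(\<integral>\<^sup>+z. ennreal (ct (fst (snd z)) (snd (snd z)) + l * c (fst (snd z)) (fst z)) \<partial>\<gamma>)
      = (\<integral>\<^sup>+z. ennreal (ct (fst (snd z)) (snd (snd z))) + ennreal l * ennreal (c (fst (snd z)) (fst z)) \<partial>\<gamma>)"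
    using assms(2) ct_nonneg c_nonneg by (intro nn_integral_cong) (simp add: ennreal_mult')
  also have "\<dots> = transport \<gamma> + ennreal l * deviation \<gamma>"
    unfolding transport_def deviation_def using m
    by (subst nn_integral_add) (simp_all add: nn_integral_cmult)
  finally show ?thesis by simp
qed

lemma coupling_imp_plan:
  assumes "\<pi> \<in> couplings \<mu>\<^sub>0 \<nu>" "0 \<le> l"
  obtains \<gamma> where "\<gamma> \<in> plans"
    "transport \<gamma> + ennreal l * deviation \<gamma> \<le> (\<integral>\<^sup>+u. ennreal (envelope l u) \<partial>\<pi>)"
proof (rule minimizing_plan[OF compact_x compact_xy kernel_lsc[OF assms(2)] kernel_nonneg[OF assms(2)]
      couplingsD(1)[OF assms(1)]])
  fix G :: "('x \<times> 'x \<times> 'y) measure"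
  assume G: "G \<in> borel_probs" "distr G borel snd = \<pi>"
    and le: "(\<integral>\<^sup>+q. ennreal (ct (fst q) (snd (snd q)) + l * c (fst q) (fst (snd q))) \<partial>G)
      \<le> (\<integral>\<^sup>+u. ennreal (INF x. ct (fst (x, u)) (snd (snd (x, u))) + l * c (fst (x, u)) (fst (snd (x, u)))) \<partial>\<pi>)"
  \<comment> \<open>\<open>minimizing_plan\<close> puts the minimized variable in front of its
    parameter \<open>(w, y)\<close>; plans have the order \<open>(w, x, y)\<close>.\<close>
  define S where "S q = (fst (snd q), fst q, snd (snd q))" for q :: "'x \<times> 'x \<times> 'y"
  have "continuous_on UNIV S"
    unfolding S_def by (intro continuous_on_Pair continuous_on_fst continuous_on_snd continuous_on_id)
  then have S: "S \<in> borel_measurable borel" by (rule borel_measurable_continuous_onI)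
  have ss: "(\<lambda>z :: 'x \<times> 'x \<times> 'y. snd (snd z)) \<in> borel_measurable borel"
    by (intro measurable_compose[OF measurable_snd_borel measurable_snd_borel])
  have GS: "distr G borel S \<in> borel_probs" using G(1) S by (rule distr_borel_probs)
  have "distr (distr G borel S) borel fst = distr (distr G borel snd) borel fst"
    by (subst (1 2) distr_distr_borel[OF G(1)]) (simp_all add: S S_def measurable_fst_borel measurable_snd_borel)
  moreover have "distr (distr G borel S) borel (\<lambda>z. snd (snd z)) = distr (distr G borel snd) borel snd"
    by (subst (1 2) distr_distr_borel[OF G(1)]) (simp_all add: S ss measurable_snd_borel, simp add: S_def)
  ultimately have plan: "distr G borel S \<in> plans"
    using GS couplingsD[OF assms(1)] by (simp add: plans_def G(2))
  have lsc: "lsc (\<lambda>z :: 'x \<times> 'x \<times> 'y. ct (fst (snd z)) (snd (snd z)) + l * c (fst (snd z)) (fst z))"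
    by (intro lsc_add lsc_cmult transport_cost_lsc deviation_cost_lsc assms(2))
  have "transport (distr G borel S) + ennreal l * deviation (distr G borel S)
      = (\<integral>\<^sup>+q. ennreal (ct (fst q) (snd (snd q)) + l * c (fst q) (fst (snd q))) \<partial>G)"
    unfolding lagrangian_eq[OF GS assms(2)]
    using lsc_borel_measurable[OF lsc] by (subst nn_integral_distr_borel[OF G(1) S]) (simp_all add: S_def)
  also have "\<dots> \<le> (\<integral>\<^sup>+u. ennreal (envelope l u) \<partial>\<pi>)" using le by (simp add: envelope_def)
  finally show thesis using plan that by blast
qed

text \<open>Forgetting \<open>x\<close> only lowers the cost, because the envelope is the pointwise
  minimum over \<open>x\<close>. This is the easy converse of \<open>coupling_imp_plan\<close>,
  where \<open>x\<close> has to be constructed.\<close>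

lemma plan_imp_coupling:
  assumes "\<gamma> \<in> plans" "0 \<le> l"
  obtains \<pi> where "\<pi> \<in> couplings \<mu>\<^sub>0 \<nu>"
    "(\<integral>\<^sup>+u. ennreal (envelope l u) \<partial>\<pi>) \<le> transport \<gamma> + ennreal l * deviation \<gamma>"
proof -
  note \<gamma> = plansD[OF assms(1)]
  define S where "S z = (fst z, snd (snd z))" for z :: "'x \<times> 'x \<times> 'y"
  have "continuous_on UNIV S"
    unfolding S_def by (intro continuous_on_Pair continuous_on_fst continuous_on_snd continuous_on_id)
  then have S: "S \<in> borel_measurable borel" by (rule borel_measurable_continuous_onI)
  have "distr \<gamma> borel S \<in> couplings \<mu>\<^sub>0 \<nu>"
  proof (rule couplingsI)
    show "distr \<gamma> borel S \<in> borel_probs" using \<gamma>(1) S by (rule distr_borel_probs)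
    show "distr (distr \<gamma> borel S) borel fst = \<mu>\<^sub>0"
      using \<gamma>(2) by (subst distr_distr_borel[OF \<gamma>(1) S measurable_fst_borel]) (simp add: S_def)
    show "distr (distr \<gamma> borel S) borel snd = \<nu>"
      using \<gamma>(3) by (subst distr_distr_borel[OF \<gamma>(1) S measurable_snd_borel]) (simp add: S_def)
  qed
  moreover have "(\<integral>\<^sup>+u. ennreal (envelope l u) \<partial>distr \<gamma> borel S) \<le> transport \<gamma> + ennreal l * deviation \<gamma>"
    unfolding lagrangian_eq[OF \<gamma>(1) assms(2)]
    using lsc_borel_measurable[OF envelope_lsc[OF assms(2)]]
    by (subst nn_integral_distr_borel[OF \<gamma>(1) S])
      (auto intro!: nn_integral_mono ennreal_leI order_trans[OF envelope_le[OF assms(2)]] simp: S_def)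
  ultimately show thesis by (rule that)
qed

lemma plans_subsequence:
  assumes "\<And>n. \<gamma> n \<in> plans"
  obtains r :: "nat \<Rightarrow> nat" and N where "strict_mono r" "N \<in> plans"
    "transport N \<le> liminf (\<lambda>n. transport (\<gamma> (r n)))" "deviation N \<le> liminf (\<lambda>n. deviation (\<gamma> (r n)))"
proof (rule weakly_convergent_subsequence[OF compact_xxy plansD(1)[OF assms]])
  fix r :: "nat \<Rightarrow> nat" and N
  assume r: "strict_mono r" and N: "N \<in> borel_probs" and lim: "weak_limit (\<lambda>n. \<gamma> (r n)) N"
  have "distr N borel fst = \<mu>\<^sub>0" "distr N borel (\<lambda>z. snd (snd z)) = \<nu>"
    by (intro weak_limit_distr[OF lim N] plansD[OF assms] continuous_on_fst continuous_on_snd continuous_on_id)+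
  with N have "N \<in> plans" by (simp add: plans_def)
  moreover have "transport N \<le> liminf (\<lambda>n. transport (\<gamma> (r n)))"
    "deviation N \<le> liminf (\<lambda>n. deviation (\<gamma> (r n)))"
    using lim transport_cost_lsc deviation_cost_lsc unfolding weak_limit_def transport_def deviation_def by blast+
  ultimately show thesis using r that by blast
qed

text \<open>Leaving \<open>w\<close> in place, \<open>x = w\<close>, costs nothing as
  \<open>c x x = 0\<close>. So the constraint is feasible for every \<open>\<delta> \<ge> 0\<close>,
  including 0.\<close>

lemma stationary_plan: "\<exists>\<gamma>\<in>plans. deviation \<gamma> = 0"
proof -
  obtain \<pi> where \<pi>: "\<pi> \<in> couplings \<mu>\<^sub>0 \<nu>" using couplings_nonempty[OF \<mu>\<^sub>0 \<nu>] by blast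
  define S where "S u = (fst u, fst u, snd u)" for u :: "'x \<times> 'y"
  have "continuous_on UNIV S"
    unfolding S_def by (intro continuous_on_Pair continuous_on_fst continuous_on_snd continuous_on_id)
  then have S: "S \<in> borel_measurable borel" by (rule borel_measurable_continuous_onI)
  note P = couplingsD[OF \<pi>]
  have "distr \<pi> borel S \<in> borel_probs" using P(1) S by (rule distr_borel_probs)
  moreover have "distr (distr \<pi> borel S) borel fst = \<mu>\<^sub>0"
    using P(2) by (subst distr_distr_borel[OF P(1) S measurable_fst_borel]) (simp add: S_def)
  moreover have "distr (distr \<pi> borel S) borel (\<lambda>z. snd (snd z)) = \<nu>"
    using P(3) by (subst distr_distr_borel[OF P(1) S measurable_compose[OF measurable_snd_borel measurable_snd_borel]])
      (simp add: S_def)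
  moreover have "deviation (distr \<pi> borel S) = 0"
    unfolding deviation_def using lsc_borel_measurable[OF deviation_cost_lsc]
    by (subst nn_integral_distr_borel[OF P(1) S]) (simp_all add: S_def c_refl)
  ultimately show ?thesis by (auto simp: plans_def)
qed

lemma optimal_plan:
  assumes "0 \<le> \<delta>"
  obtains \<gamma> where "\<gamma> \<in> plans" "deviation \<gamma> \<le> ennreal \<delta>"
    "\<And>\<gamma>'. \<gamma>' \<in> plans \<Longrightarrow> deviation \<gamma>' \<le> ennreal \<delta> \<Longrightarrow> transport \<gamma> \<le> transport \<gamma>'"
proof (rule attains_min_sequentially[of "{\<gamma> \<in> plans. deviation \<gamma> \<le> ennreal \<delta>}" transport])
  show "{\<gamma> \<in> plans. deviation \<gamma> \<le> ennreal \<delta>} \<noteq> {}" using stationary_plan by force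
next
  fix X :: "nat \<Rightarrow> _" assume X: "\<And>n. X n \<in> {\<gamma> \<in> plans. deviation \<gamma> \<le> ennreal \<delta>}"
  then have "X n \<in> plans" for n by blast
  then obtain r N where N: "strict_mono (r :: nat \<Rightarrow> nat)" "N \<in> plans"
    "transport N \<le> liminf (\<lambda>n. transport (X (r n)))" "deviation N \<le> liminf (\<lambda>n. deviation (X (r n)))"
    by (rule plans_subsequence)
  note N(4)
  also have "liminf (\<lambda>n. deviation (X (r n))) \<le> liminf (\<lambda>n. ennreal \<delta>)"
    by (intro Liminf_mono always_eventually allI) (use X in blast)
  also have "\<dots> = ennreal \<delta>" by (rule Liminf_const) simp
  finally show "\<exists>r. \<exists>l\<in>{\<gamma> \<in> plans. deviation \<gamma> \<le> ennreal \<delta>}.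
      strict_mono (r :: nat \<Rightarrow> nat) \<and> transport l \<le> liminf (\<lambda>n. transport (X (r n)))"
    using N(1-3) by blast
qed (use that in blast)

lemma c_swap_lsc: "lsc (\<lambda>(w, x). c x w)"
  using c_compose_lsc[of snd fst] by (simp add: case_prod_beta' continuous_on_fst continuous_on_snd)

lemma c_swap_measurable: "(\<lambda>u. c (snd u) (fst u)) \<in> borel_measurable borel"
  by (intro lsc_borel_measurable c_compose_lsc continuous_on_fst continuous_on_snd continuous_on_id)

lemma ct_measurable: "(\<lambda>u. ct (fst u) (snd u)) \<in> borel_measurable borel"
  by (intro lsc_borel_measurable ct_compose_lsc continuous_on_fst continuous_on_snd continuous_on_id)

text \<open>The candidate is the law of the middle coordinate. Only inequalities result, since the
  two projections of a plan are couplings that may fail to be optimal.\<close>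

lemma plan_imp_ball:
  assumes "\<gamma> \<in> plans" "deviation \<gamma> \<le> ennreal \<delta>" "0 \<le> \<delta>"
  obtains \<mu> where "\<mu> \<in> ot_ball (\<lambda>w x. c x w) \<delta> \<mu>\<^sub>0" "ot_cost ct \<mu> \<nu> \<le> enn2ereal (transport \<gamma>)"
proof -
  note \<gamma> = plansD[OF assms(1)]
  define S where "S z = (fst z, fst (snd z))" for z :: "'x \<times> 'x \<times> 'y"
  define M where "M = distr \<gamma> borel (\<lambda>z. fst (snd z))"
  have "continuous_on UNIV S"
    unfolding S_def by (intro continuous_on_Pair continuous_on_fst continuous_on_snd continuous_on_id)
  then have S: "S \<in> borel_measurable borel" by (rule borel_measurable_continuous_onI)
  have fs: "(\<lambda>z :: 'x \<times> 'x \<times> 'y. fst (snd z)) \<in> borel_measurable borel"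
    by (intro measurable_compose[OF measurable_snd_borel measurable_fst_borel])
  have M: "M \<in> borel_probs" unfolding M_def using \<gamma>(1) fs by (rule distr_borel_probs)
  have 1: "distr \<gamma> borel S \<in> couplings \<mu>\<^sub>0 M"
  proof (rule couplingsI)
    show "distr \<gamma> borel S \<in> borel_probs" using \<gamma>(1) S by (rule distr_borel_probs)
    show "distr (distr \<gamma> borel S) borel fst = \<mu>\<^sub>0"
      using \<gamma>(2) by (subst distr_distr_borel[OF \<gamma>(1) S measurable_fst_borel]) (simp add: S_def)
    show "distr (distr \<gamma> borel S) borel snd = M"
      by (subst distr_distr_borel[OF \<gamma>(1) S measurable_snd_borel]) (simp add: S_def M_def)
  qed
  have 2: "distr \<gamma> borel snd \<in> couplings M \<nu>"
  proof (rule couplingsI)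
    show "distr \<gamma> borel snd \<in> borel_probs" using \<gamma>(1) measurable_snd_borel by (rule distr_borel_probs)
    show "distr (distr \<gamma> borel snd) borel fst = M"
      by (subst distr_distr_borel[OF \<gamma>(1) measurable_snd_borel measurable_fst_borel]) (simp add: M_def)
    show "distr (distr \<gamma> borel snd) borel snd = \<nu>"
      using \<gamma>(3) by (subst distr_distr_borel[OF \<gamma>(1) measurable_snd_borel measurable_snd_borel]) simp
  qed
  have "(\<integral>\<^sup>+u. ennreal (c (snd u) (fst u)) \<partial>distr \<gamma> borel S) = deviation \<gamma>"
    unfolding deviation_def using c_swap_measurable
    by (subst nn_integral_distr_borel[OF \<gamma>(1) S]) (simp_all add: S_def case_prod_beta)
  then have "ot_cost (\<lambda>w x. c x w) \<mu>\<^sub>0 M \<le> enn2ereal (deviation \<gamma>)"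
    using ot_cost_le[OF _ 1, of "\<lambda>w x. c x w"] c_nonneg by simp
  also have "\<dots> \<le> ereal \<delta>" using assms(2,3) unfolding less_eq_ennreal.rep_eq by simp
  finally have "M \<in> ot_ball (\<lambda>w x. c x w) \<delta> \<mu>\<^sub>0" using M by (simp add: ot_ball_def)
  moreover have "(\<integral>\<^sup>+u. ennreal (ct (fst u) (snd u)) \<partial>distr \<gamma> borel snd) = transport \<gamma>"
    unfolding transport_def using ct_measurable
    by (subst nn_integral_distr_borel[OF \<gamma>(1) measurable_snd_borel]) (simp_all add: case_prod_beta)
  then have "ot_cost ct M \<nu> \<le> enn2ereal (transport \<gamma>)"
    using ot_cost_le[of ct, OF ct_nonneg 2] by simp
  ultimately show thesis by (rule that)
qed

text \<open>Membership in the ball bounds an infimum, and it is attainment by an optimal coupling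
  that gives a deviation of at most \<open>\<delta>\<close> without an extra epsilon. The two
  optimal couplings share the marginal \<open>\<mu>\<close> and are glued along it.\<close>

lemma ball_imp_plan:
  assumes "\<mu> \<in> ot_ball (\<lambda>w x. c x w) \<delta> \<mu>\<^sub>0" "0 \<le> \<delta>"
  obtains \<gamma> where "\<gamma> \<in> plans" "deviation \<gamma> \<le> ennreal \<delta>" "enn2ereal (transport \<gamma>) = ot_cost ct \<mu> \<nu>"
proof -
  have \<mu>: "\<mu> \<in> borel_probs" and le: "ot_cost (\<lambda>w x. c x w) \<mu>\<^sub>0 \<mu> \<le> ereal \<delta>"
    using assms(1) by (simp_all add: ot_ball_def)
  obtain \<pi>\<^sub>1 where 1: "\<pi>\<^sub>1 \<in> couplings \<mu>\<^sub>0 \<mu>"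
    "ot_cost (\<lambda>w x. c x w) \<mu>\<^sub>0 \<mu> = enn2ereal (\<integral>\<^sup>+u. ennreal (c (snd u) (fst u)) \<partial>\<pi>\<^sub>1)"
    by (rule ot_cost_attained[OF compact_x compact_x \<mu>\<^sub>0 \<mu> c_swap_lsc c_nonneg])
  obtain \<pi>\<^sub>2 where 2: "\<pi>\<^sub>2 \<in> couplings \<mu> \<nu>"
    "ot_cost ct \<mu> \<nu> = enn2ereal (\<integral>\<^sup>+u. ennreal (ct (fst u) (snd u)) \<partial>\<pi>\<^sub>2)"
    by (rule ot_cost_attained[OF compact_x compact_y \<mu> \<nu> ct_lsc ct_nonneg])
  obtain \<gamma> :: "('x \<times> 'x \<times> 'y) measure" where \<gamma>: "\<gamma> \<in> borel_probs"
    "distr \<gamma> borel (\<lambda>z. (fst z, fst (snd z))) = \<pi>\<^sub>1" "distr \<gamma> borel snd = \<pi>\<^sub>2"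
    by (rule gluing[OF compact_x compact_x compact_y 1(1) 2(1)])
  have S: "(\<lambda>z :: 'x \<times> 'x \<times> 'y. (fst z, fst (snd z))) \<in> borel_measurable borel"
    by (intro borel_measurable_continuous_onI continuous_on_Pair continuous_on_fst continuous_on_snd continuous_on_id)
  have "distr \<gamma> borel fst = \<mu>\<^sub>0"
    using couplingsD(2)[OF 1(1)] unfolding \<gamma>(2)[symmetric]
    by (subst (asm) distr_distr_borel[OF \<gamma>(1) S measurable_fst_borel]) simp
  moreover have "distr \<gamma> borel (\<lambda>z. snd (snd z)) = \<nu>"
    using couplingsD(3)[OF 2(1)] unfolding \<gamma>(3)[symmetric]
    by (subst (asm) distr_distr_borel[OF \<gamma>(1) measurable_snd_borel measurable_snd_borel]) simp
  ultimately have "\<gamma> \<in> plans" using \<gamma>(1) by (simp add: plans_def)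
  moreover have "(\<integral>\<^sup>+u. ennreal (c (snd u) (fst u)) \<partial>\<pi>\<^sub>1) = deviation \<gamma>"
    unfolding deviation_def \<gamma>(2)[symmetric] using c_swap_measurable
    by (subst nn_integral_distr_borel[OF \<gamma>(1) S]) (simp_all add: case_prod_beta)
  then have "deviation \<gamma> \<le> ennreal \<delta>"
    using le assms(2) unfolding 1(2) less_eq_ennreal.rep_eq by simp
  moreover have "(\<integral>\<^sup>+u. ennreal (ct (fst u) (snd u)) \<partial>\<pi>\<^sub>2) = transport \<gamma>"
    unfolding transport_def \<gamma>(3)[symmetric] using ct_measurable
    by (subst nn_integral_distr_borel[OF \<gamma>(1) measurable_snd_borel]) (simp_all add: case_prod_beta)
  then have "enn2ereal (transport \<gamma>) = ot_cost ct \<mu> \<nu>" using 2(2) by simp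
  ultimately show thesis by (rule that)
qed

lemma relaxed_ot_cost_attained:
  assumes "0 \<le> \<delta>"
  obtains \<gamma> \<mu> where "\<gamma> \<in> plans" "deviation \<gamma> \<le> ennreal \<delta>"
    "\<And>\<gamma>'. \<gamma>' \<in> plans \<Longrightarrow> deviation \<gamma>' \<le> ennreal \<delta> \<Longrightarrow> transport \<gamma> \<le> transport \<gamma>'"
    "relaxed_ot_cost ct (\<lambda>w x. c x w) \<delta> \<mu>\<^sub>0 \<nu> = enn2ereal (transport \<gamma>)"
    "is_arg_min (\<lambda>\<mu>. ot_cost ct \<mu> \<nu>) (\<lambda>\<mu>. \<mu> \<in> ot_ball (\<lambda>w x. c x w) \<delta> \<mu>\<^sub>0) \<mu>"
proof (rule optimal_plan[OF assms])
  fix \<gamma> assume \<gamma>: "\<gamma> \<in> plans" "deviation \<gamma> \<le> ennreal \<delta>"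
    and opt: "\<And>\<gamma>'. \<gamma>' \<in> plans \<Longrightarrow> deviation \<gamma>' \<le> ennreal \<delta> \<Longrightarrow> transport \<gamma> \<le> transport \<gamma>'"
  obtain \<mu> where \<mu>: "\<mu> \<in> ot_ball (\<lambda>w x. c x w) \<delta> \<mu>\<^sub>0" "ot_cost ct \<mu> \<nu> \<le> enn2ereal (transport \<gamma>)"
    by (rule plan_imp_ball[OF \<gamma> assms])
  have le: "enn2ereal (transport \<gamma>) \<le> ot_cost ct \<mu>' \<nu>" if \<mu>': "\<mu>' \<in> ot_ball (\<lambda>w x. c x w) \<delta> \<mu>\<^sub>0" for \<mu>'
  proof (rule ball_imp_plan[OF \<mu>' assms])
    fix \<gamma>' assume "\<gamma>' \<in> plans" "deviation \<gamma>' \<le> ennreal \<delta>" "enn2ereal (transport \<gamma>') = ot_cost ct \<mu>' \<nu>"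
    with opt[of \<gamma>'] show ?thesis unfolding less_eq_ennreal.rep_eq by simp
  qed
  show thesis
  proof (rule that[OF \<gamma> opt])
    show "relaxed_ot_cost ct (\<lambda>w x. c x w) \<delta> \<mu>\<^sub>0 \<nu> = enn2ereal (transport \<gamma>)"
      unfolding relaxed_ot_cost_def
    proof (rule antisym)
      show "(INF \<mu>\<in>ot_ball (\<lambda>w x. c x w) \<delta> \<mu>\<^sub>0. ot_cost ct \<mu> \<nu>) \<le> enn2ereal (transport \<gamma>)"
        using \<mu> by (rule INF_lower2)
    qed (rule INF_greatest, rule le)
    show "is_arg_min (\<lambda>\<mu>. ot_cost ct \<mu> \<nu>) (\<lambda>\<mu>. \<mu> \<in> ot_ball (\<lambda>w x. c x w) \<delta> \<mu>\<^sub>0) \<mu>"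
      unfolding is_arg_min_linorder using \<mu> le order_trans by blast
  qed
qed

section \<open>Separation in the plane and the duality theorem\<close>

text \<open>The sign conditions are explicit because \<open>ennreal\<close> sends negative reals to
  0: a plan of zero deviation would otherwise put negative \<open>u\<close> into the set, outside
  the quadrant that the separation lemma requires.\<close>

definition attainable :: "(real \<times> real) set" where
  "attainable = {(u, v). 0 \<le> u \<and> 0 \<le> v \<and> (\<exists>\<gamma>\<in>plans. deviation \<gamma> \<le> ennreal u \<and> transport \<gamma> \<le> ennreal v)}"

lemma attainable_convex: "convex attainable"
proof (rule convexI)
  fix x y and s t :: real
  assume xy: "x \<in> attainable" "y \<in> attainable" and st: "0 \<le> s" "0 \<le> t" "s + t = 1"
  obtain u\<^sub>1 v\<^sub>1 \<gamma>\<^sub>1 where 1: "x = (u\<^sub>1, v\<^sub>1)" "0 \<le> u\<^sub>1" "0 \<le> v\<^sub>1" "\<gamma>\<^sub>1 \<in> plans"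
    "deviation \<gamma>\<^sub>1 \<le> ennreal u\<^sub>1" "transport \<gamma>\<^sub>1 \<le> ennreal v\<^sub>1"
    using xy(1) unfolding attainable_def by blast
  obtain u\<^sub>2 v\<^sub>2 \<gamma>\<^sub>2 where 2: "y = (u\<^sub>2, v\<^sub>2)" "0 \<le> u\<^sub>2" "0 \<le> v\<^sub>2" "\<gamma>\<^sub>2 \<in> plans"
    "deviation \<gamma>\<^sub>2 \<le> ennreal u\<^sub>2" "transport \<gamma>\<^sub>2 \<le> ennreal v\<^sub>2"
    using xy(2) unfolding attainable_def by blast
  have s: "s \<le> 1" "t = 1 - s" using st by auto
  have comb: "ennreal u * ennreal s + ennreal v * ennreal (1 - s) = ennreal (s * u + (1 - s) * v)"
    if "0 \<le> u" "0 \<le> v" for u v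
    using that st(1) s(1) by (simp add: ennreal_mult mult.commute)
  note P1 = plansD[OF 1(4)] and P2 = plansD[OF 2(4)]
  obtain \<gamma> where \<gamma>: "\<gamma> \<in> borel_probs"
    and int: "\<forall>f\<in>borel_measurable borel.
      (\<integral>\<^sup>+z. f z \<partial>\<gamma>) = (\<integral>\<^sup>+z. f z \<partial>\<gamma>\<^sub>1) * ennreal s + (\<integral>\<^sup>+z. f z \<partial>\<gamma>\<^sub>2) * ennreal (1 - s)"
    by (rule mixture[OF P1(1) P2(1) st(1) s(1)])
  have "distr \<gamma> borel fst = \<mu>\<^sub>0"
    using mixture_distr[OF P1(1) P2(1) \<gamma> st(1) s(1) int measurable_fst_borel P1(2) P2(2)] .
  moreover have "distr \<gamma> borel (\<lambda>z. snd (snd z)) = \<nu>"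
    using mixture_distr[OF P1(1) P2(1) \<gamma> st(1) s(1) int
        measurable_compose[OF measurable_snd_borel measurable_snd_borel] P1(3) P2(3)] .
  ultimately have "\<gamma> \<in> plans" using \<gamma> by (simp add: plans_def)
  moreover have "deviation \<gamma> \<le> ennreal (s * u\<^sub>1 + t * u\<^sub>2)"
  proof -
    have "deviation \<gamma> = deviation \<gamma>\<^sub>1 * ennreal s + deviation \<gamma>\<^sub>2 * ennreal (1 - s)"
      unfolding deviation_def
      by (intro bspec[OF int] measurable_compose[OF lsc_borel_measurable[OF deviation_cost_lsc] measurable_ennreal])
    also have "\<dots> \<le> ennreal u\<^sub>1 * ennreal s + ennreal u\<^sub>2 * ennreal (1 - s)"
      using 1 2 by (intro add_mono mult_right_mono) auto
    also have "\<dots> = ennreal (s * u\<^sub>1 + t * u\<^sub>2)"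
      unfolding s(2) by (rule comb) fact+
    finally show ?thesis .
  qed
  moreover have "transport \<gamma> \<le> ennreal (s * v\<^sub>1 + t * v\<^sub>2)"
  proof -
    have "transport \<gamma> = transport \<gamma>\<^sub>1 * ennreal s + transport \<gamma>\<^sub>2 * ennreal (1 - s)"
      unfolding transport_def
      by (intro bspec[OF int] measurable_compose[OF lsc_borel_measurable[OF transport_cost_lsc] measurable_ennreal])
    also have "\<dots> \<le> ennreal v\<^sub>1 * ennreal s + ennreal v\<^sub>2 * ennreal (1 - s)"
      using 1 2 by (intro add_mono mult_right_mono) auto
    also have "\<dots> = ennreal (s * v\<^sub>1 + t * v\<^sub>2)"
      unfolding s(2) by (rule comb) fact+
    finally show ?thesis .
  qed
  ultimately show "s *\<^sub>R x + t *\<^sub>R y \<in> attainable"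
    using 1(1-3) 2(1-3) st by (auto simp: attainable_def)
qed

text \<open>Upper bounds on the two costs survive a weak limit, whereas the exact values may drop.
  This is why the set consists of all dominating pairs.\<close>

lemma attainable_closed: "closed attainable"
  unfolding closed_sequential_limits
proof (intro allI impI, elim conjE)
  fix x l assume x: "\<forall>n. x n \<in> attainable" and lim: "x \<longlonglongrightarrow> l"
  have "\<forall>n. 0 \<le> fst (x n) \<and> 0 \<le> snd (x n) \<and>
      (\<exists>\<gamma>\<in>plans. deviation \<gamma> \<le> ennreal (fst (x n)) \<and> transport \<gamma> \<le> ennreal (snd (x n)))"
    using x by (simp add: attainable_def case_prod_beta)
  then have pos: "0 \<le> fst (x n)" "0 \<le> snd (x n)"
    and ex: "\<exists>\<gamma>. \<gamma> \<in> plans \<and> deviation \<gamma> \<le> ennreal (fst (x n)) \<and> transport \<gamma> \<le> ennreal (snd (x n))" for n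
    by blast+
  have "\<exists>\<gamma>. \<forall>n. \<gamma> n \<in> plans \<and> deviation (\<gamma> n) \<le> ennreal (fst (x n)) \<and> transport (\<gamma> n) \<le> ennreal (snd (x n))"
    by (intro choice allI ex)
  then obtain \<gamma> where \<gamma>: "\<And>n. \<gamma> n \<in> plans"
    "\<And>n. deviation (\<gamma> n) \<le> ennreal (fst (x n))" "\<And>n. transport (\<gamma> n) \<le> ennreal (snd (x n))" by blast
  obtain r N where r: "strict_mono (r :: nat \<Rightarrow> nat)" and N: "N \<in> plans"
    "transport N \<le> liminf (\<lambda>n. transport (\<gamma> (r n)))" "deviation N \<le> liminf (\<lambda>n. deviation (\<gamma> (r n)))"
    by (rule plans_subsequence[OF \<gamma>(1)])
  have lr: "(\<lambda>n. x (r n)) \<longlonglongrightarrow> l" using LIMSEQ_subseq_LIMSEQ[OF lim r] by (simp add: o_def)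
  have "liminf (\<lambda>n. deviation (\<gamma> (r n))) \<le> liminf (\<lambda>n. ennreal (fst (x (r n))))"
    by (intro Liminf_mono always_eventually allI \<gamma>(2))
  also have "\<dots> = ennreal (fst l)"
    by (intro lim_imp_Liminf tendsto_ennrealI tendsto_fst lr) simp
  finally have "deviation N \<le> ennreal (fst l)" using N(3) by simp
  moreover have "liminf (\<lambda>n. transport (\<gamma> (r n))) \<le> liminf (\<lambda>n. ennreal (snd (x (r n))))"
    by (intro Liminf_mono always_eventually allI \<gamma>(3))
  moreover have "\<dots> = ennreal (snd l)"
    by (intro lim_imp_Liminf tendsto_ennrealI tendsto_snd lr) simp
  ultimately have "deviation N \<le> ennreal (fst l) \<and> transport N \<le> ennreal (snd l)" using N(2) by simp
  moreover have "0 \<le> fst l" by (rule LIMSEQ_le_const[OF tendsto_fst[OF lim]]) (use pos in blast)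
  moreover have "0 \<le> snd l" by (rule LIMSEQ_le_const[OF tendsto_snd[OF lim]]) (use pos in blast)
  ultimately show "l \<in> attainable" using N(1) by (auto simp: attainable_def case_prod_beta)
qed

text \<open>The separation only sees plans with finite costs. For the others the claim holds because
  the Lagrangian is \<open>top\<close>; when only the deviation is infinite this rests on
  \<open>0 < l\<close>, since \<open>0 * top = 0\<close> in \<open>ennreal\<close>.\<close>

lemma multiplier_exists:
  assumes "0 \<le> \<delta>"
    and opt: "\<And>\<gamma>. \<gamma> \<in> plans \<Longrightarrow> deviation \<gamma> \<le> ennreal \<delta> \<Longrightarrow> ereal a < enn2ereal (transport \<gamma>)"
  obtains l where "0 < l"
    "\<And>\<gamma>. \<gamma> \<in> plans \<Longrightarrow> ereal (l * \<delta> + a) \<le> enn2ereal (transport \<gamma> + ennreal l * deviation \<gamma>)"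
proof (rule separate_upward_closed[OF attainable_convex attainable_closed _ assms(1), where a=a])
  show "(\<delta>, a) \<notin> attainable"
  proof
    assume "(\<delta>, a) \<in> attainable"
    then obtain \<gamma> where \<gamma>: "0 \<le> a" "\<gamma> \<in> plans" "deviation \<gamma> \<le> ennreal \<delta>" "transport \<gamma> \<le> ennreal a"
      by (auto simp: attainable_def)
    from \<gamma>(4,1) have "enn2ereal (transport \<gamma>) \<le> ereal a" unfolding less_eq_ennreal.rep_eq by simp
    with opt[OF \<gamma>(2,3)] show False by simp
  qed
next
  fix u v assume "(u, v) \<in> attainable"
  then show "0 \<le> u \<and> 0 \<le> v" by (simp add: attainable_def)
next
  fix u v u' v' assume "(u, v) \<in> attainable" and le: "u \<le> u'" "v \<le> v'"
  then obtain \<gamma> where "0 \<le> u" "0 \<le> v" "\<gamma> \<in> plans" "deviation \<gamma> \<le> ennreal u" "transport \<gamma> \<le> ennreal v"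
    by (auto simp: attainable_def)
  moreover from this have "deviation \<gamma> \<le> ennreal u'" "transport \<gamma> \<le> ennreal v'"
    using le ennreal_leI order_trans by blast+
  ultimately show "(u', v') \<in> attainable" using le by (auto simp: attainable_def)
next
  fix l assume l: "0 < l" and sep: "\<And>u v. (u, v) \<in> attainable \<Longrightarrow> l * \<delta> + a \<le> v + l * u"
  show thesis
  proof (rule that[OF l])
    fix \<gamma> assume \<gamma>: "\<gamma> \<in> plans"
    show "ereal (l * \<delta> + a) \<le> enn2ereal (transport \<gamma> + ennreal l * deviation \<gamma>)"
    proof (cases "transport \<gamma> = top \<or> deviation \<gamma> = top")
      case True
      then have "transport \<gamma> + ennreal l * deviation \<gamma> = top"
        using l by (auto simp: ennreal_mult_eq_top_iff)
      then show ?thesis unfolding \<open>transport \<gamma> + ennreal l * deviation \<gamma> = top\<close> top_ennreal.rep_eq by simp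
    next
      case False
      then obtain u v where uv: "0 \<le> u" "deviation \<gamma> = ennreal u" "0 \<le> v" "transport \<gamma> = ennreal v"
        by (metis ennreal_cases)
      then have "deviation \<gamma> \<le> ennreal u \<and> transport \<gamma> \<le> ennreal v" by simp
      with \<gamma> uv(1,3) have "(u, v) \<in> attainable" unfolding attainable_def by blast
      then have "l * \<delta> + a \<le> v + l * u" by (rule sep)
      moreover have "transport \<gamma> + ennreal l * deviation \<gamma> = ennreal (v + l * u)"
        using uv l by (simp add: ennreal_mult)
      moreover have "0 \<le> v + l * u" using uv l by simp
      ultimately show ?thesis by (simp only: enn2ereal_ennreal ereal_less_eq)
    qed
  qed
qed

text \<open>Minus the inner maximum of the dual problem. It may be \<open>top\<close>, and then the
  dual objective is minus infinity.\<close>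

definition dual_value :: "real \<Rightarrow> ennreal" where
  "dual_value l = (INF \<pi>\<in>couplings \<mu>\<^sub>0 \<nu>. \<integral>\<^sup>+u. ennreal (envelope l u) \<partial>\<pi>)"

lemma dual_value_le: "\<pi> \<in> couplings \<mu>\<^sub>0 \<nu> \<Longrightarrow> dual_value l \<le> (\<integral>\<^sup>+u. ennreal (envelope l u) \<partial>\<pi>)"
  unfolding dual_value_def by (rule INF_lower)

lemma dual_value_attained:
  assumes "0 \<le> l"
  obtains \<pi> where "\<pi> \<in> couplings \<mu>\<^sub>0 \<nu>" "dual_value l = (\<integral>\<^sup>+u. ennreal (envelope l u) \<partial>\<pi>)"
proof (rule coupling_minimizer[OF compact_x compact_y \<mu>\<^sub>0 \<nu> envelope_lsc[OF assms]])
  fix \<pi> assume "\<pi> \<in> couplings \<mu>\<^sub>0 \<nu>" and min: "\<And>\<pi>'. \<pi>' \<in> couplings \<mu>\<^sub>0 \<nu> \<Longrightarrow>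
    (\<integral>\<^sup>+z. ennreal (envelope l z) \<partial>\<pi>) \<le> (\<integral>\<^sup>+z. ennreal (envelope l z) \<partial>\<pi>')"
  moreover from this have "dual_value l = (\<integral>\<^sup>+u. ennreal (envelope l u) \<partial>\<pi>)"
    using dual_value_le unfolding dual_value_def by (intro antisym INF_greatest) auto
  ultimately show thesis by (intro that)
qed

lemma ext_expectation_dual_h:
  "0 \<le> l \<Longrightarrow> ext_expectation \<pi> (\<lambda>(w, y). dual_h ct c w y l) = - enn2ereal (\<integral>\<^sup>+u. ennreal (envelope l u) \<partial>\<pi>)"
  using ext_expectation_nonpos[of "envelope l" \<pi>, OF envelope_nonneg]
  by (simp add: dual_h_eq case_prod_beta')

lemma dual_maximizer:
  assumes "0 \<le> l"
  shows "\<exists>\<pi>. is_arg_max (\<lambda>\<pi>. ext_expectation \<pi> (\<lambda>(w, y). dual_h ct c w y l)) (\<lambda>\<pi>. \<pi> \<in> couplings \<mu>\<^sub>0 \<nu>) \<pi>"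
proof (rule dual_value_attained[OF assms])
  fix \<pi> assume \<pi>: "\<pi> \<in> couplings \<mu>\<^sub>0 \<nu>" "dual_value l = (\<integral>\<^sup>+u. ennreal (envelope l u) \<partial>\<pi>)"
  then show ?thesis
    unfolding is_arg_max_linorder ext_expectation_dual_h[OF assms] using dual_value_le[of _ l]
    by (intro exI[of _ \<pi>]) (simp add: less_eq_ennreal.rep_eq)
qed

lemma dual_objective_eq:
  assumes "0 \<le> l"
  shows "dual_objective ct c \<delta> \<mu>\<^sub>0 \<nu> l = ereal (l * \<delta>) - enn2ereal (dual_value l)"
proof (rule dual_value_attained[OF assms])
  fix \<pi> assume \<pi>: "\<pi> \<in> couplings \<mu>\<^sub>0 \<nu>" "dual_value l = (\<integral>\<^sup>+u. ennreal (envelope l u) \<partial>\<pi>)"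
  have "(SUP \<pi>\<in>couplings \<mu>\<^sub>0 \<nu>. - enn2ereal (\<integral>\<^sup>+u. ennreal (envelope l u) \<partial>\<pi>)) = - enn2ereal (dual_value l)"
  proof (rule SUP_eqI)
    fix \<pi>' assume "\<pi>' \<in> couplings \<mu>\<^sub>0 \<nu>"
    then show "- enn2ereal (\<integral>\<^sup>+u. ennreal (envelope l u) \<partial>\<pi>') \<le> - enn2ereal (dual_value l)"
      using dual_value_le[of \<pi>' l] by (simp add: less_eq_ennreal.rep_eq)
  qed (use \<pi> in auto)
  then show ?thesis
    unfolding dual_objective_def ext_expectation_dual_h[OF assms] by (simp add: minus_ereal_def)
qed

lemma weak_duality:
  assumes "0 \<le> l" "0 \<le> \<delta>" "\<gamma> \<in> plans" "deviation \<gamma> \<le> ennreal \<delta>"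
  shows "- enn2ereal (transport \<gamma>) \<le> dual_objective ct c \<delta> \<mu>\<^sub>0 \<nu> l"
proof (rule plan_imp_coupling[OF assms(3,1)])
  fix \<pi> assume \<pi>: "\<pi> \<in> couplings \<mu>\<^sub>0 \<nu>"
    and "(\<integral>\<^sup>+u. ennreal (envelope l u) \<partial>\<pi>) \<le> transport \<gamma> + ennreal l * deviation \<gamma>"
  then have "dual_value l \<le> transport \<gamma> + ennreal l * deviation \<gamma>"
    using dual_value_le[OF \<pi>] order_trans by blast
  also have "\<dots> \<le> transport \<gamma> + ennreal l * ennreal \<delta>"
    using assms(4) by (intro add_left_mono mult_left_mono) auto
  also have "\<dots> = transport \<gamma> + ennreal (l * \<delta>)" using assms by (simp add: ennreal_mult)
  finally have "enn2ereal (dual_value l) \<le> enn2ereal (transport \<gamma>) + ereal (l * \<delta>)"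
    using assms(1,2) unfolding less_eq_ennreal.rep_eq plus_ennreal.rep_eq by simp
  then show ?thesis
    unfolding dual_objective_eq[OF assms(1)]
    by (cases "enn2ereal (dual_value l)"; cases "enn2ereal (transport \<gamma>)") auto
qed

text \<open>The multiplier bounds the Lagrangian of every plan from below; the bound is used at a
  plan built from an optimal coupling of the inner dual problem, whose Lagrangian is at most the
  dual value.\<close>

lemma strong_duality:
  assumes "0 \<le> \<delta>"
    and opt: "\<And>\<gamma>. \<gamma> \<in> plans \<Longrightarrow> deviation \<gamma> \<le> ennreal \<delta> \<Longrightarrow> ereal a < enn2ereal (transport \<gamma>)"
  shows "\<exists>l\<ge>0. dual_objective ct c \<delta> \<mu>\<^sub>0 \<nu> l \<le> - ereal a"
proof (rule multiplier_exists[OF assms(1) opt])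
  fix l assume l: "0 < l"
    and L: "\<And>\<gamma>. \<gamma> \<in> plans \<Longrightarrow> ereal (l * \<delta> + a) \<le> enn2ereal (transport \<gamma> + ennreal l * deviation \<gamma>)"
  then have l0: "0 \<le> l" by simp
  obtain \<pi> where \<pi>: "\<pi> \<in> couplings \<mu>\<^sub>0 \<nu>" "dual_value l = (\<integral>\<^sup>+u. ennreal (envelope l u) \<partial>\<pi>)"
    by (rule dual_value_attained[OF l0])
  obtain \<gamma> where \<gamma>: "\<gamma> \<in> plans" "transport \<gamma> + ennreal l * deviation \<gamma> \<le> dual_value l"
    unfolding \<pi>(2) by (rule coupling_imp_plan[OF \<pi>(1) l0])
  have "ereal (l * \<delta> + a) \<le> enn2ereal (dual_value l)"
    using L[OF \<gamma>(1)] \<gamma>(2) unfolding less_eq_ennreal.rep_eq by (rule order_trans)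
  then have "dual_objective ct c \<delta> \<mu>\<^sub>0 \<nu> l \<le> ereal (l * \<delta>) - ereal (l * \<delta> + a)"
    unfolding dual_objective_eq[OF l0] by (intro ereal_minus_mono order_refl)
  also have "\<dots> = - ereal a" by simp
  finally show ?thesis using l0 by blast
qed

theorem duality:
  assumes "0 \<le> \<delta>"
  shows "relaxed_ot_cost ct (\<lambda>w x. c x w) \<delta> \<mu>\<^sub>0 \<nu> = - (INF l\<in>{0..}. dual_objective ct c \<delta> \<mu>\<^sub>0 \<nu> l)"
    (is "?G = - ?I")
proof (rule relaxed_ot_cost_attained[OF assms])
  fix \<gamma> assume \<gamma>: "\<gamma> \<in> plans" "deviation \<gamma> \<le> ennreal \<delta>"
    and opt: "\<And>\<gamma>'. \<gamma>' \<in> plans \<Longrightarrow> deviation \<gamma>' \<le> ennreal \<delta> \<Longrightarrow> transport \<gamma> \<le> transport \<gamma>'"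
    and G: "?G = enn2ereal (transport \<gamma>)"
  have "- ?G \<le> ?I" unfolding G by (rule INF_greatest) (use weak_duality[OF _ assms \<gamma>] in simp)
  moreover have "?I \<le> - ?G"
  proof (rule ccontr)
    assume "\<not> ?I \<le> - ?G"
    then have "- ?I < ?G" by (simp add: not_le ereal_uminus_less_reorder)
    \<comment> \<open>A real number strictly between the two sides exists even if one of them is
      infinite.\<close>
    then obtain a where a: "- ?I < ereal a" "ereal a < ?G" using ereal_dense2 by blast
    have "ereal a < enn2ereal (transport \<gamma>')" if "\<gamma>' \<in> plans" "deviation \<gamma>' \<le> ennreal \<delta>" for \<gamma>'
      using a(2) opt[OF that] unfolding G less_eq_ennreal.rep_eq by (rule order.strict_trans2)
    then obtain l where l: "0 \<le> l" "dual_objective ct c \<delta> \<mu>\<^sub>0 \<nu> l \<le> - ereal a"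
      using strong_duality[OF assms] by blast
    have "l \<in> {0..}" using l(1) by simp
    then have "?I \<le> - ereal a" using l(2) by (rule INF_lower2)
    with a(1) show False by (simp add: ereal_uminus_less_reorder)
  qed
  ultimately have "?I = - ?G" by (rule antisym[rotated])
  then show ?thesis by simp
qed

section \<open>Attainment of the minimum over the multiplier\<close>

text \<open>The factor \<open>M = max 1 (l / l\<^sub>0)\<close> satisfies both
  \<open>ct \<le> M * ct\<close> and \<open>l * c \<le> M * l\<^sub>0 * c\<close>; evaluate at a
  minimizer for \<open>l\<^sub>0\<close>. This compares dual values at different multipliers even if
  neither \<open>ct\<close> nor \<open>c\<close> is integrable.\<close>

lemma envelope_scale:
  assumes "0 < l\<^sub>0" "0 \<le> l"
  shows "envelope l u \<le> max 1 (l / l\<^sub>0) * envelope l\<^sub>0 u"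
proof -
  let ?M = "max 1 (l / l\<^sub>0)"
  obtain x where x: "envelope l\<^sub>0 u = ct x (snd u) + l\<^sub>0 * c x (fst u)"
    by (rule envelope_attained[of l\<^sub>0 u]) (use assms in auto)
  have "l = l / l\<^sub>0 * l\<^sub>0" using assms(1) by simp
  also have "\<dots> \<le> ?M * l\<^sub>0" using assms(1) by (intro mult_right_mono) auto
  finally have "l * c x (fst u) \<le> ?M * l\<^sub>0 * c x (fst u)" using c_nonneg by (rule mult_right_mono)
  moreover have "1 * ct x (snd u) \<le> ?M * ct x (snd u)" using ct_nonneg by (intro mult_right_mono) auto
  ultimately have "ct x (snd u) + l * c x (fst u) \<le> ?M * envelope l\<^sub>0 u"
    unfolding x distrib_left mult.assoc by linarith
  with envelope_le[OF assms(2), of u x] show ?thesis by linarith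
qed

lemma nn_integral_envelope_scale:
  assumes "0 < l\<^sub>0" "0 \<le> l" "\<pi> \<in> couplings \<mu>\<^sub>0 \<nu>"
  shows "(\<integral>\<^sup>+u. ennreal (envelope l u) \<partial>\<pi>)
    \<le> ennreal (max 1 (l / l\<^sub>0)) * (\<integral>\<^sup>+u. ennreal (envelope l\<^sub>0 u) \<partial>\<pi>)"
proof -
  have m: "(\<lambda>u. ennreal (envelope l\<^sub>0 u)) \<in> borel_measurable \<pi>"
    using lsc_borel_measurable[OF envelope_lsc[of l\<^sub>0]] assms(1)
    by (simp add: borel_probsD(4)[OF couplingsD(1)[OF assms(3)]])
  have "(\<integral>\<^sup>+u. ennreal (envelope l u) \<partial>\<pi>)
      \<le> (\<integral>\<^sup>+u. ennreal (max 1 (l / l\<^sub>0)) * ennreal (envelope l\<^sub>0 u) \<partial>\<pi>)"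
    using envelope_scale[OF assms(1,2)] envelope_nonneg[of l\<^sub>0] assms(1)
    by (intro nn_integral_mono) (simp add: ennreal_mult[symmetric] ennreal_leI)
  also have "\<dots> = ennreal (max 1 (l / l\<^sub>0)) * (\<integral>\<^sup>+u. ennreal (envelope l\<^sub>0 u) \<partial>\<pi>)"
    by (rule nn_integral_cmult[OF m])
  finally show ?thesis .
qed

lemma dual_value_scale:
  assumes "0 < l\<^sub>0" "0 \<le> l"
  shows "dual_value l \<le> ennreal (max 1 (l / l\<^sub>0)) * dual_value l\<^sub>0"
proof -
  have "0 \<le> l\<^sub>0" using assms(1) by simp
  then obtain \<pi> where \<pi>: "\<pi> \<in> couplings \<mu>\<^sub>0 \<nu>" "dual_value l\<^sub>0 = (\<integral>\<^sup>+u. ennreal (envelope l\<^sub>0 u) \<partial>\<pi>)"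
    by (rule dual_value_attained)
  show ?thesis
    unfolding \<pi>(2) by (rule order_trans[OF dual_value_le[OF \<pi>(1)] nn_integral_envelope_scale[OF assms \<pi>(1)]])
qed

text \<open>At multiplier 0 the envelope depends on \<open>y\<close> alone, and \<open>y\<close> has
  law \<open>\<nu>\<close> under every coupling. So a coupling chosen for another multiplier is
  optimal at 0 as well.\<close>

lemma nn_integral_envelope_0:
  assumes "\<pi> \<in> couplings \<mu>\<^sub>0 \<nu>"
  shows "(\<integral>\<^sup>+u. ennreal (envelope 0 u) \<partial>\<pi>) = dual_value 0"
proof -
  have val: "(\<integral>\<^sup>+u. ennreal (envelope 0 u) \<partial>\<pi>') = (\<integral>\<^sup>+y. ennreal (INF x. ct x y) \<partial>\<nu>)"
    if \<pi>': "\<pi>' \<in> couplings \<mu>\<^sub>0 \<nu>" for \<pi>'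
  proof -
    have "lsc (\<lambda>y. INF x. (\<lambda>(x, y). ct x y) (x, y))"
      by (rule lsc_INF_compact[OF compact_y ct_lsc _ compact_x]) (auto simp: ct_nonneg)
    then have "(\<lambda>y. ennreal (INF x. ct x y)) \<in> borel_measurable borel"
      using lsc_borel_measurable by fastforce
    then have "(\<integral>\<^sup>+y. ennreal (INF x. ct x y) \<partial>distr \<pi>' borel snd) = (\<integral>\<^sup>+u. ennreal (INF x. ct x (snd u)) \<partial>\<pi>')"
      by (rule nn_integral_distr_borel[OF couplingsD(1)[OF \<pi>'] measurable_snd_borel])
    then show ?thesis unfolding couplingsD(3)[OF \<pi>'] by (simp add: envelope_def)
  qed
  obtain \<pi>\<^sub>0 where "\<pi>\<^sub>0 \<in> couplings \<mu>\<^sub>0 \<nu>" "dual_value 0 = (\<integral>\<^sup>+u. ennreal (envelope 0 u) \<partial>\<pi>\<^sub>0)"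
    by (rule dual_value_attained[OF order_refl])
  with assms show ?thesis by (simp add: val)
qed

text \<open>A minimizer \<open>x\<close> of the cost at multiplier 0 is fixed: its cost at
  \<open>Y n\<close> bounds the envelope from above and converges, while \<open>envelope 0\<close>
  bounds it from below as \<open>c\<close> is nonnegative.\<close>

lemma envelope_tendsto_0:
  assumes "\<And>n. 0 \<le> Y n" "Y \<longlonglongrightarrow> 0"
  shows "(\<lambda>n. envelope (Y n) u) \<longlonglongrightarrow> envelope 0 u"
proof -
  obtain x where x: "envelope 0 u = ct x (snd u) + 0 * c x (fst u)"
    by (rule envelope_attained[OF order_refl])
  have 1: "\<forall>\<^sub>F n in sequentially. envelope (Y n) u \<le> ct x (snd u) + Y n * c x (fst u)"
    using assms(1) by (intro always_eventually allI envelope_le)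
  have "(\<lambda>n. ct x (snd u) + Y n * c x (fst u)) \<longlonglongrightarrow> ct x (snd u) + 0 * c x (fst u)"
    by (intro tendsto_intros assms(2))
  then have 2: "(\<lambda>n. ct x (snd u) + Y n * c x (fst u)) \<longlonglongrightarrow> envelope 0 u" unfolding x .
  have "envelope 0 u \<le> envelope (Y n) u" for n
  proof -
    obtain z where z: "envelope (Y n) u = ct z (snd u) + Y n * c z (fst u)"
      by (rule envelope_attained[OF assms(1)])
    have "envelope 0 u \<le> ct z (snd u)" using envelope_le[of 0 u z] by simp
    also have "\<dots> \<le> envelope (Y n) u" unfolding z using assms(1)[of n] c_nonneg[of z "fst u"] by simp
    finally show ?thesis .
  qed
  then have "\<forall>\<^sub>F n in sequentially. envelope 0 u \<le> envelope (Y n) u" by (intro always_eventually allI)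
  from this 1 tendsto_const 2 show ?thesis by (rule tendsto_sandwich)
qed

lemma dual_value_usc:
  assumes fin: "\<And>l. 0 \<le> l \<Longrightarrow> dual_value l < top"
    and Y: "\<And>n. 0 \<le> Y n" "Y \<longlonglongrightarrow> l" "0 \<le> l"
  obtains B where "\<And>n. dual_value (Y n) \<le> B n" "B \<longlonglongrightarrow> dual_value l"
proof (cases "l = 0")
  case False
  then have l: "0 < l" using Y(3) by simp
  show thesis
  proof (rule that)
    show "dual_value (Y n) \<le> ennreal (max 1 (Y n / l)) * dual_value l" for n
      by (rule dual_value_scale[OF l Y(1)])
    have "(\<lambda>n. max 1 (Y n / l)) \<longlonglongrightarrow> max 1 (l / l)"
      by (intro tendsto_intros Y(2) False)
    then have "(\<lambda>n. ennreal (max 1 (Y n / l))) \<longlonglongrightarrow> ennreal 1" using False by (intro tendsto_ennrealI) simp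
    then have "(\<lambda>n. ennreal (max 1 (Y n / l)) * dual_value l) \<longlonglongrightarrow> ennreal 1 * dual_value l"
      by (rule tendsto_mult_ennreal[OF _ tendsto_const]) (use fin[OF Y(3)] in auto)
    then show "(\<lambda>n. ennreal (max 1 (Y n / l)) * dual_value l) \<longlonglongrightarrow> dual_value l" by simp
  qed
next
  case True
  obtain \<pi> where \<pi>: "\<pi> \<in> couplings \<mu>\<^sub>0 \<nu>" "dual_value 1 = (\<integral>\<^sup>+u. ennreal (envelope 1 u) \<partial>\<pi>)"
    by (rule dual_value_attained[OF zero_le_one])
  have meas: "(\<lambda>u. ennreal (envelope l u)) \<in> borel_measurable \<pi>" if "0 \<le> l" for l
    using lsc_borel_measurable[OF envelope_lsc[OF that]]
    by (simp add: borel_probsD(4)[OF couplingsD(1)[OF \<pi>(1)]])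
  obtain K where K: "\<And>n. Y n \<le> K"
    using convergent_imp_Bseq[OF convergentI[OF Y(2)]] unfolding Bseq_def
    by (metis abs_le_D1 real_norm_def)
  define M where "M = max 1 K"
  show thesis
  proof (rule that)
    show "dual_value (Y n) \<le> (\<integral>\<^sup>+u. ennreal (envelope (Y n) u) \<partial>\<pi>)" for n
      by (rule dual_value_le[OF \<pi>(1)])
    have "(\<lambda>n. \<integral>\<^sup>+u. ennreal (envelope (Y n) u) \<partial>\<pi>) \<longlonglongrightarrow> (\<integral>\<^sup>+u. ennreal (envelope 0 u) \<partial>\<pi>)"
    proof (rule nn_integral_dominated_convergence[where w="\<lambda>u. ennreal M * ennreal (envelope 1 u)"])
      show "AE u in \<pi>. ennreal (envelope (Y n) u) \<le> ennreal M * ennreal (envelope 1 u)" for n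
      proof (rule AE_I2)
        fix u
        have "envelope (Y n) u \<le> max 1 (Y n / 1) * envelope 1 u"
          by (rule envelope_scale[OF zero_less_one Y(1)])
        also have "\<dots> \<le> M * envelope 1 u"
          using K[of n] envelope_nonneg[of 1 u] by (intro mult_right_mono) (auto simp: M_def)
        finally show "ennreal (envelope (Y n) u) \<le> ennreal M * ennreal (envelope 1 u)"
          using envelope_nonneg[of 1 u] by (simp add: ennreal_mult[symmetric] M_def ennreal_leI)
      qed
      have "(\<integral>\<^sup>+u. ennreal M * ennreal (envelope 1 u) \<partial>\<pi>) = ennreal M * dual_value 1"
        unfolding \<pi>(2) by (rule nn_integral_cmult[OF meas]) simp
      also have "\<dots> < \<infinity>" using fin[of 1] by (simp add: ennreal_mult_less_top)
      finally show "(\<integral>\<^sup>+u. ennreal M * ennreal (envelope 1 u) \<partial>\<pi>) < \<infinity>" .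
      show "AE u in \<pi>. (\<lambda>n. ennreal (envelope (Y n) u)) \<longlonglongrightarrow> ennreal (envelope 0 u)"
        using envelope_tendsto_0[of Y] Y True by (intro AE_I2 tendsto_ennrealI) simp
    qed (auto intro!: meas Y(1) borel_measurable_times_ennreal)
    then show "(\<lambda>n. \<integral>\<^sup>+u. ennreal (envelope (Y n) u) \<partial>\<pi>) \<longlonglongrightarrow> dual_value l"
      unfolding nn_integral_envelope_0[OF \<pi>(1)] True .
  qed
qed

text \<open>The choice \<open>x = w\<close> bounds \<open>envelope l\<close> at
  \<open>(w, y)\<close> by \<open>ct w y\<close> for every \<open>l\<close>, so dividing by
  \<open>l\<close> gives pointwise convergence to 0. The dominating function is
  \<open>envelope 1\<close>, since \<open>ct w y\<close> may fail to be integrable. With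
  \<open>\<epsilon> = \<delta>\<close> the dual objective becomes nonnegative for large
  \<open>l\<close>.\<close>

lemma dual_value_sublinear:
  assumes fin: "dual_value 1 < top" and "0 < \<epsilon>"
  obtains L where "1 \<le> L" "\<And>l. L \<le> l \<Longrightarrow> dual_value l \<le> ennreal (l * \<epsilon>)"
proof -
  obtain \<pi> where \<pi>: "\<pi> \<in> couplings \<mu>\<^sub>0 \<nu>" "dual_value 1 = (\<integral>\<^sup>+u. ennreal (envelope 1 u) \<partial>\<pi>)"
    by (rule dual_value_attained[OF zero_le_one])
  have meas: "(\<lambda>u. ennreal (a * envelope l u)) \<in> borel_measurable \<pi>" if "0 \<le> l" for l a
    using lsc_borel_measurable[OF envelope_lsc[OF that]]
    by (simp add: borel_probsD(4)[OF couplingsD(1)[OF \<pi>(1)]])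
  let ?s = "\<lambda>n. 1 / real (Suc n)"
  have "(\<lambda>n. \<integral>\<^sup>+u. ennreal (?s n * envelope (Suc n) u) \<partial>\<pi>) \<longlonglongrightarrow> (\<integral>\<^sup>+u. 0 \<partial>\<pi>)"
  proof (rule nn_integral_dominated_convergence[where w="\<lambda>u. ennreal (1 * envelope 1 u)"])
    show "AE u in \<pi>. ennreal (?s n * envelope (Suc n) u) \<le> ennreal (1 * envelope 1 u)" for n
    proof (rule AE_I2, rule ennreal_leI)
      fix u
      have "?s n * envelope (Suc n) u \<le> ?s n * (max 1 (real (Suc n) / 1) * envelope 1 u)"
        by (intro mult_left_mono envelope_scale) auto
      also have "\<dots> = 1 * envelope 1 u" by simp
      finally show "?s n * envelope (Suc n) u \<le> 1 * envelope 1 u" .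
    qed
    show "AE u in \<pi>. (\<lambda>n. ennreal (?s n * envelope (Suc n) u)) \<longlonglongrightarrow> 0"
    proof (rule AE_I2)
      fix u
      have "(\<lambda>n. ?s n * ct (fst u) (snd u)) \<longlonglongrightarrow> 0 * ct (fst u) (snd u)"
        by (intro tendsto_mult tendsto_const LIMSEQ_Suc[OF lim_1_over_n])
      then have "(\<lambda>n. ?s n * ct (fst u) (snd u)) \<longlonglongrightarrow> 0" by simp
      then have "(\<lambda>n. ?s n * envelope (Suc n) u) \<longlonglongrightarrow> 0"
      proof (rule Lim_null_comparison[rotated], intro always_eventually allI)
        fix n
        have "envelope (Suc n) u \<le> ct (fst u) (snd u)"
          using envelope_le[of "Suc n" u "fst u"] by (simp add: c_refl)
        then show "norm (?s n * envelope (Suc n) u) \<le> ?s n * ct (fst u) (snd u)"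
          using envelope_nonneg[of "Suc n" u] by (simp add: divide_right_mono)
      qed
      then show "(\<lambda>n. ennreal (?s n * envelope (Suc n) u)) \<longlonglongrightarrow> 0"
        using tendsto_ennrealI by fastforce
    qed
  qed (use fin \<pi>(2) in \<open>(intro meas; simp) | simp\<close>)+
  then have "(\<lambda>n. \<integral>\<^sup>+u. ennreal (?s n * envelope (Suc n) u) \<partial>\<pi>) \<longlonglongrightarrow> 0" by simp
  then have "\<forall>\<^sub>F n in sequentially. (\<integral>\<^sup>+u. ennreal (?s n * envelope (Suc n) u) \<partial>\<pi>) < ennreal \<epsilon>"
    by (rule order_tendstoD(2)) (use \<open>0 < \<epsilon>\<close> in simp)
  then obtain n where n: "(\<integral>\<^sup>+u. ennreal (?s n * envelope (Suc n) u) \<partial>\<pi>) < ennreal \<epsilon>"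
    using eventually_happens' sequentially_bot by blast
  define L where "L = real (Suc n)"
  have L: "1 \<le> L" by (simp add: L_def)
  have "dual_value L \<le> (\<integral>\<^sup>+u. ennreal (envelope L u) \<partial>\<pi>)" by (rule dual_value_le[OF \<pi>(1)])
  also have "\<dots> = (\<integral>\<^sup>+u. ennreal L * ennreal (1 / L * envelope L u) \<partial>\<pi>)"
    using L envelope_nonneg[of L] by (intro nn_integral_cong) (simp add: ennreal_mult[symmetric])
  also have "\<dots> = ennreal L * (\<integral>\<^sup>+u. ennreal (1 / L * envelope L u) \<partial>\<pi>)"
    using L by (intro nn_integral_cmult meas) simp
  also have "\<dots> \<le> ennreal L * ennreal \<epsilon>"
    using n by (intro mult_left_mono) (simp_all add: L_def)
  finally have dL: "dual_value L \<le> ennreal (L * \<epsilon>)" using L assms(2) by (simp add: ennreal_mult)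
  show thesis
  proof (rule that[OF L])
    fix l assume l: "L \<le> l"
    \<comment> \<open>One good multiplier \<open>L\<close> is enough: the scaling factor
      \<open>l / L\<close> turns the bound \<open>L * \<epsilon>\<close> into
      \<open>l * \<epsilon>\<close>.\<close>
    have "dual_value l \<le> ennreal (max 1 (l / L)) * dual_value L"
      using L l by (intro dual_value_scale) auto
    also have "\<dots> \<le> ennreal (max 1 (l / L)) * ennreal (L * \<epsilon>)"
      using dL by (rule mult_left_mono) simp
    also have "\<dots> = ennreal (l * \<epsilon>)"
      using L l assms(2) by (simp add: max_def ennreal_mult[symmetric])
    finally show "dual_value l \<le> ennreal (l * \<epsilon>)" .
  qed
qed

text \<open>If the dual value is infinite somewhere, the objective is minus infinity there and
  nothing remains to be minimized. Otherwise the search is confined to a compact interval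
  \<open>{0..L}\<close>, because the objective is at most 0 at multiplier 0 and at least 0 beyond
  \<open>L\<close>; positivity of \<open>\<delta>\<close> enters through the choice of
  \<open>L\<close>.\<close>

lemma dual_minimizer:
  assumes "0 < \<delta>"
  shows "\<exists>l. is_arg_min (dual_objective ct c \<delta> \<mu>\<^sub>0 \<nu>) (\<lambda>l. 0 \<le> l) l"
proof (cases "\<exists>l\<ge>0. dual_value l = top")
  case True
  then obtain l where l: "0 \<le> l" "dual_value l = top" by blast
  then have "dual_objective ct c \<delta> \<mu>\<^sub>0 \<nu> l = - \<infinity>"
    by (simp add: dual_objective_eq top_ennreal.rep_eq)
  with l(1) show ?thesis by (intro exI[of _ l]) (simp add: is_arg_min_linorder)
next
  case False
  then have fin: "dual_value l < top" if "0 \<le> l" for l using that by (auto simp: less_top)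
  obtain L where L: "1 \<le> L" "\<And>l. L \<le> l \<Longrightarrow> dual_value l \<le> ennreal (l * \<delta>)"
    using dual_value_sublinear[OF fin[OF zero_le_one] assms] by metis
  let ?F = "dual_objective ct c \<delta> \<mu>\<^sub>0 \<nu>"
  show ?thesis
  proof (rule attains_min_sequentially[of "{0..L}" ?F])
    show "{0..L} \<noteq> {}" using L(1) by simp
  next
    fix X :: "nat \<Rightarrow> real" assume X: "\<And>n. X n \<in> {0..L}"
    obtain l r where l: "l \<in> {0..L}" and r: "strict_mono (r :: nat \<Rightarrow> nat)" and "(X \<circ> r) \<longlonglongrightarrow> l"
      using seq_compactE[OF compact_Icc[of 0 L, unfolded compact_eq_seq_compact_metric]] X by metis
    then have lim: "(\<lambda>n. X (r n)) \<longlonglongrightarrow> l" by (simp add: o_def)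
    have X0: "0 \<le> X (r n)" for n using X[of "r n"] by simp
    have l0: "0 \<le> l" using l by simp
    obtain B where B: "\<And>n. dual_value (X (r n)) \<le> B n" "B \<longlonglongrightarrow> dual_value l"
      using dual_value_usc[OF fin X0 lim l0] by metis
    have "(\<lambda>n. ereal (X (r n) * \<delta>) - enn2ereal (B n)) \<longlonglongrightarrow> ereal (l * \<delta>) - enn2ereal (dual_value l)"
      using fin[OF l0] by (intro tendsto_diff_ereal_general tendsto_enn2erealI B(2) tendsto_ereal
          tendsto_mult tendsto_const lim) simp
    then have "?F l = liminf (\<lambda>n. ereal (X (r n) * \<delta>) - enn2ereal (B n))"
      unfolding dual_objective_eq[OF l0] by (intro lim_imp_Liminf[symmetric]) simp_all
    also have "\<dots> \<le> liminf (\<lambda>n. ?F (X (r n)))"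
      unfolding dual_objective_eq[OF X0] using B(1)
      by (intro Liminf_mono always_eventually allI ereal_minus_mono order_refl) (simp add: less_eq_ennreal.rep_eq)
    finally show "\<exists>r. \<exists>l\<in>{0..L}. strict_mono (r :: nat \<Rightarrow> nat) \<and> ?F l \<le> liminf (\<lambda>n. ?F (X (r n)))"
      using l r by blast
  next
    fix l assume l: "l \<in> {0..L}" and min: "\<And>x. x \<in> {0..L} \<Longrightarrow> ?F l \<le> ?F x"
    have "?F l \<le> ?F x" if "0 \<le> x" for x
    proof (cases "x \<le> L")
      case False
      have "?F l \<le> ?F 0" using L(1) by (intro min) simp
      also have "\<dots> \<le> 0"
        unfolding dual_objective_eq[OF order_refl] by (cases "enn2ereal (dual_value 0)")
          (use enn2ereal_nonneg[of "dual_value 0"] in auto)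
      also have "0 \<le> ?F x"
      proof -
        have "enn2ereal (dual_value x) \<le> ereal (x * \<delta>)"
          using L(2)[of x] False that assms unfolding less_eq_ennreal.rep_eq by simp
        then show ?thesis unfolding dual_objective_eq[OF that]
          by (cases "enn2ereal (dual_value x)") auto
      qed
      finally show ?thesis .
    qed (use that min in simp)
    with l show ?thesis by (intro exI[of _ l]) (simp add: is_arg_min_linorder)
  qed
qed

end

theorem theorem2:
  fixes ct :: "'x::polish_space \<Rightarrow> 'y::polish_space \<Rightarrow> real"
    and c :: "'x \<Rightarrow> 'x \<Rightarrow> real"
    and \<mu>\<^sub>0 :: "'x measure" and \<nu> :: "'y measure" and \<delta> :: real
  assumes "compact (UNIV :: 'x set)" and "compact (UNIV :: 'y set)"
    and "\<And>x y. 0 \<le> ct x y" and "lsc (\<lambda>(x, y). ct x y)"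
    and "\<And>x w. 0 \<le> c x w" and "lsc (\<lambda>(x, w). c x w)" and "\<And>x. c x x = 0"
    and "\<mu>\<^sub>0 \<in> borel_probs" and "\<nu> \<in> borel_probs" and "0 \<le> \<delta>"
  shows
    \<comment> \<open>The cost of moving \<open>w\<close> (drawn from \<open>\<mu>\<^sub>0\<close>) to \<open>x\<close> is \<open>c x w\<close> on both sides.\<close>
    "relaxed_ot_cost ct (\<lambda>w x. c x w) \<delta> \<mu>\<^sub>0 \<nu> = - (INF l\<in>{0..}. dual_objective ct c \<delta> \<mu>\<^sub>0 \<nu> l)
   \<and> (0 < \<delta> \<longrightarrow> (\<exists>l. is_arg_min (dual_objective ct c \<delta> \<mu>\<^sub>0 \<nu>) (\<lambda>l. 0 \<le> l) l))
   \<and> (\<forall>l\<ge>0. \<exists>\<pi>. is_arg_max (\<lambda>\<pi>. ext_expectation \<pi> (\<lambda>(w, y). dual_h ct c w y l))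
                            (\<lambda>\<pi>. \<pi> \<in> couplings \<mu>\<^sub>0 \<nu>) \<pi>)
   \<and> (\<exists>\<mu>. is_arg_min (\<lambda>\<mu>. ot_cost ct \<mu> \<nu>) (\<lambda>\<mu>. \<mu> \<in> ot_ball (\<lambda>w x. c x w) \<delta> \<mu>\<^sub>0) \<mu>)
   \<and> (\<forall>\<mu>\<in>borel_probs. \<exists>\<pi>. is_arg_min (\<lambda>\<pi>. ext_expectation \<pi> (\<lambda>(x, y). ct x y))
                                     (\<lambda>\<pi>. \<pi> \<in> couplings \<mu> \<nu>) \<pi>)
   \<and> (\<forall>\<mu>\<in>borel_probs. \<exists>\<pi>. is_arg_min (\<lambda>\<pi>. ext_expectation \<pi> (\<lambda>(w, x). c x w))
                                     (\<lambda>\<pi>. \<pi> \<in> couplings \<mu>\<^sub>0 \<mu>) \<pi>)"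
proof -
  interpret relaxed_transport ct c \<mu>\<^sub>0 \<nu> using assms(1-9) by unfold_locales
  have "\<exists>\<mu>. is_arg_min (\<lambda>\<mu>. ot_cost ct \<mu> \<nu>) (\<lambda>\<mu>. \<mu> \<in> ot_ball (\<lambda>w x. c x w) \<delta> \<mu>\<^sub>0) \<mu>"
    by (rule relaxed_ot_cost_attained[OF assms(10)]) (rule exI)
  moreover have "\<exists>\<pi>. is_arg_min (\<lambda>\<pi>. ext_expectation \<pi> (\<lambda>(x, y). ct x y)) (\<lambda>\<pi>. \<pi> \<in> couplings \<mu> \<nu>) \<pi>"
    if "\<mu> \<in> borel_probs" for \<mu>
    by (rule ot_cost_attained[OF compact_x compact_y that \<nu> ct_lsc ct_nonneg]) (rule exI)
  moreover have "\<exists>\<pi>. is_arg_min (\<lambda>\<pi>. ext_expectation \<pi> (\<lambda>(w, x). c x w)) (\<lambda>\<pi>. \<pi> \<in> couplings \<mu>\<^sub>0 \<mu>) \<pi>"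
    if "\<mu> \<in> borel_probs" for \<mu>
    by (rule ot_cost_attained[OF compact_x compact_x \<mu>\<^sub>0 that c_swap_lsc c_nonneg]) (rule exI)
  ultimately show ?thesis
    using duality[OF assms(10)] dual_minimizer dual_maximizer by blast
qed

end
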